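(* Let $N\ge 2$, let $\Omega_0\subset\mathbb{R}^N$ be a bounded strictly convex domain, let $K>0$ be a constant and let $\varepsilon>0$. Consider the two-player zero-sum game in $\Omega_0$ described in the context, with values $u_p^\varepsilon$ for Paul and $u_c^\varepsilon$ for Carol. Then the game has a value $u^\varepsilon$, i.e. $u^\varepsilon(x_0):=u_p^\varepsilon(x_0)=u_c^\varepsilon(x_0)$, and $u^\varepsilon$ is characterized as the unique solution to $$u^\varepsilon(x)=\sup_{A}\inf_{B}\left\{\frac{1}{\sigma(A\cap B)}\int_{A\cap B}u^\varepsilon(x+\varepsilon v)\,d\sigma(v)\right\}+\varepsilon^2K\quad\text{for }x\in\Omega_0,\qquad u^\varepsilon(x)=0\quad\text{for }x\in\mathbb{R}^N\setminus\Omega_0 .$$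
   Context: $\sigma$ is the surface measure on the unit sphere $S^{N-1}\subset\mathbb{R}^N$, and $\delta_\varepsilon=\varepsilon^{1/2}$. Every supremum or infimum over sets $A$ or $B$ is taken over subsets of $S^{N-1}$ with surface measure greater than or equal to $\frac12\sigma(S^{N-1})+\delta_\varepsilon$. The game: let $x_0\in\Omega_0$ be the initial position. At the $i$-th round, Paul chooses a set of unit vectors $A_i\subset S^{N-1}$ with $\sigma(A_i)\ge\frac12\sigma(S^{N-1})+\delta_\varepsilon$ and Carol chooses a set $B_i\subset S^{N-1}$ with $\sigma(B_i)\ge\frac12\sigma(S^{N-1})+\delta_\varepsilon$. (Both sets are slightly bigger than half of the sphere, so $A_i\cap B_i$ has positive measure.) Once these choices are made, the next position is $x_i=x_{i-1}+\varepsilon v_i$, where $v_i$ is chosen at random with uniform probability in $A_i\cap B_i$. The game ends when the position exits $\Omega_0$, and Carol pays Paul $\varepsilon^2K\times(\text{number of plays})$. Paul wants to maximize the expected payoff and Carol wants to minimize it. Denoting by $S_p$ and $S_c$ the possible strategies of Paul and Carol, respectively, and by $\mathbb{E}^{x_0}_{S_p,S_c}$ the corresponding expectation for the game starting at $x_0$, the values for Paul and for Carol are $$u_p^\varepsilon(x_0)=\inf_{S_c}\sup_{S_p}\mathbb{E}^{x_0}_{S_p,S_c}\big[\varepsilon^2K\times(\text{number of plays})\big],\qquad u_c^\varepsilon(x_0)=\sup_{S_p}\inf_{S_c}\mathbb{E}^{x_0}_{S_p,S_c}\big[\varepsilon^2K\times(\text{number of plays})\big].$$ The game is said to have a value when these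 two quantities coincide. *)

theory Defs
  imports "HOL-Probability.Probability"
begin

text \<open>
  The surface measure of the unit sphere, as a Borel measure on the whole space that is carried by
  the sphere. It is given by the polar-coordinate (cone) formula: the surface measure of a set
  \<open>A\<close> of unit vectors is \<open>N\<close> times the volume of the part of the unit ball lying over \<open>A\<close>,
  where \<open>N\<close> is the dimension and \<open>sgn x = x / norm x\<close>. The total mass is \<open>N\<close> times the volume of
  the unit ball.
\<close>

definition surface_measure :: "'a::euclidean_space measure" where
  "surface_measure =
     scale_measure (ennreal (real DIM('a))) (distr (restrict_space lborel (cball 0 1 - {0})) borel sgn)"

lemma sets_surface_measure [simp, measurable_cong]: "sets surface_measure = sets borel"
  by (simp add: surface_measure_def)

lemma space_surface_measure [simp]: "space surface_measure = UNIV"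
  by (simp add: surface_measure_def space_scale_measure)

lemma borel_measurable_sgn_vec: "sgn \<in> borel_measurable (borel :: 'a::euclidean_space measure)"
  unfolding sgn_div_norm by measurable

lemma emeasure_surface_measure:
  fixes A :: "'a::euclidean_space set"
  assumes "A \<in> sets borel"
  shows "emeasure surface_measure A =
    ennreal (real DIM('a)) * emeasure lborel {x \<in> cball 0 1 - {0}. sgn x \<in> A}"
proof -
  have m: "sgn \<in> measurable (restrict_space lborel (cball 0 1 - {0})) (borel :: 'a measure)"
    using borel_measurable_sgn_vec by (intro measurable_restrict_space1) auto
  have "sgn -` A \<inter> (cball 0 1 - {0}) = {x \<in> cball 0 1 - {0}. sgn x \<in> A}" by auto
  moreover have "emeasure (restrict_space lborel (cball 0 1 - {0})) (sgn -` A \<inter> (cball 0 1 - {0}))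
     = emeasure lborel (sgn -` A \<inter> (cball 0 1 - {0}))"
    by (rule emeasure_restrict_space) auto
  ultimately show ?thesis
    using assms m by (simp add: surface_measure_def emeasure_distr space_restrict_space)
qed

lemma surface_measure_sphere:
  "emeasure surface_measure (sphere 0 1 :: 'a::euclidean_space set) =
     ennreal (real DIM('a) * unit_ball_vol DIM('a))"
proof -
  have "{x \<in> cball 0 1 - {0}. sgn x \<in> (sphere 0 1 :: 'a set)} = cball 0 1 - {0}"
    by (auto simp: norm_sgn)
  moreover have "emeasure lborel (cball 0 1 - {0} :: 'a set) = emeasure lborel (cball 0 1 :: 'a set)"
    by (rule emeasure_Diff_null_set) auto
  ultimately show ?thesis
    by (simp add: emeasure_surface_measure emeasure_cball ennreal_mult)
qed

lemma surface_measure_off_sphere: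
  "emeasure surface_measure (- sphere 0 1 :: 'a::euclidean_space set) = 0"
proof -
  have "{x \<in> cball 0 1 - {0}. sgn x \<in> (- sphere 0 1 :: 'a set)} = {}"
    by (auto simp: norm_sgn)
  moreover have "- sphere 0 1 \<in> sets (borel :: 'a measure)"
    by (intro borel_comp borel_closed) auto
  ultimately show ?thesis
    by (simp only: emeasure_surface_measure emeasure_empty mult_zero_right)
qed

lemma finite_measure_surface_measure: "finite_measure (surface_measure :: 'a::euclidean_space measure)"
proof
  have "emeasure (surface_measure :: 'a measure) (sphere 0 1 \<union> - sphere 0 1)
     \<le> emeasure (surface_measure :: 'a measure) (sphere 0 1) + emeasure (surface_measure :: 'a measure) (- sphere 0 1)"
    by (intro emeasure_subadditive) auto
  then show "emeasure (surface_measure :: 'a measure) (space surface_measure) \<noteq> \<infinity>"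
    by (auto simp: surface_measure_sphere surface_measure_off_sphere top_unique)
qed

definition strictly_convex :: "'a::euclidean_space set \<Rightarrow> bool" where
  "strictly_convex S \<longleftrightarrow>
     (\<forall>x\<in>closure S. \<forall>y\<in>closure S. x \<noteq> y \<longrightarrow> open_segment x y \<subseteq> interior S)"

definition admissible_sets :: "real \<Rightarrow> 'a::euclidean_space set set" where
  "admissible_sets \<epsilon> = {A. A \<in> sets borel \<and> A \<subseteq> sphere 0 1 \<and>
     measure surface_measure A \<ge> 1/2 * measure surface_measure (sphere 0 1 :: 'a set) + sqrt \<epsilon>}"

lemma admissible_Int:
  fixes A B :: "'a::euclidean_space set"
  assumes "\<epsilon> > 0" "A \<in> admissible_sets \<epsilon>" "B \<in> admissible_sets \<epsilon>"
  shows "2 * sqrt \<epsilon> \<le> measure surface_measure (A \<inter> B)"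
proof -
  interpret finite_measure "surface_measure :: 'a measure" by (rule finite_measure_surface_measure)
  have "measure surface_measure (A \<union> B) \<le> measure surface_measure (sphere 0 1 :: 'a set)"
    using assms by (intro finite_measure_mono) (auto simp: admissible_sets_def)
  moreover have "measure surface_measure (A \<union> B) = measure surface_measure A
      + measure surface_measure B - measure surface_measure (A \<inter> B)"
    using assms by (intro measure_Un3) (auto simp: admissible_sets_def fmeasurable_eq_sets)
  ultimately show ?thesis using assms by (simp add: admissible_sets_def)
qed

text \<open>
  A strategy \<open>S\<close> assigns to every round \<open>i \<ge> 1\<close> and every history \<open>h\<close> of positions
  \<open>h 0, \<dots>, h (i - 1)\<close> the set \<open>S i h\<close> to be chosen in that round; the value at \<open>i = 0\<close> plays
  no role. The graph of \<open>S i\<close> is required to be measurable, which is what makes the transition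
  probabilities below depend measurably on the history.
\<close>

definition strategies :: "real \<Rightarrow> (nat \<Rightarrow> (nat \<Rightarrow> 'a::euclidean_space) \<Rightarrow> 'a set) set" where
  "strategies \<epsilon> = {S. \<forall>i\<ge>1.
     (\<forall>h\<in>space (PiM {0..<i} (\<lambda>_. borel)). S i h \<in> admissible_sets \<epsilon>) \<and>
     Sigma (space (PiM {0..<i} (\<lambda>_. borel))) (S i) \<in> sets (PiM {0..<i} (\<lambda>_. borel) \<Otimes>\<^sub>M borel)}"

text \<open>The law of the \<open>i\<close>-th position given the history of the previous ones.\<close>

definition game_kernel ::
  "real \<Rightarrow> 'a::euclidean_space \<Rightarrow> (nat \<Rightarrow> (nat \<Rightarrow> 'a) \<Rightarrow> 'a set) \<Rightarrow>
   (nat \<Rightarrow> (nat \<Rightarrow> 'a) \<Rightarrow> 'a set) \<Rightarrow> nat \<Rightarrow> (nat \<Rightarrow> 'a) \<Rightarrow> 'a measure" where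
  "game_kernel \<epsilon> x0 Sp Sc i h =
     (if i = 0 then return borel x0
      else distr (uniform_measure surface_measure (Sp i h \<inter> Sc i h)) borel
             (\<lambda>v. h (i - 1) + \<epsilon> *\<^sub>R v))"

lemma Ionescu_Tulcea_game_kernel:
  fixes x0 :: "'a::euclidean_space"
  assumes eps: "\<epsilon> > 0" and S: "Sp \<in> strategies \<epsilon>" "Sc \<in> strategies \<epsilon>"
  shows "Ionescu_Tulcea (game_kernel \<epsilon> x0 Sp Sc) (\<lambda>_. borel)"
proof -
  interpret s: finite_measure "surface_measure :: 'a measure" by (rule finite_measure_surface_measure)
  have prob: "prob_space (game_kernel \<epsilon> x0 Sp Sc i h)" 
    if h: "h \<in> space (PiM {0..<i} (\<lambda>_. borel))" for i h
  proof (cases "i = 0")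
    case True
    then show ?thesis by (simp add: game_kernel_def prob_space_return)
  next
    case False
    have AB: "Sp i h \<in> admissible_sets \<epsilon>" "Sc i h \<in> admissible_sets \<epsilon>"
      using S False h by (auto simp: strategies_def)
    have "measure surface_measure (Sp i h \<inter> Sc i h) > 0"
      using admissible_Int[OF eps AB] eps by (smt (verit) real_sqrt_gt_zero)
    then have "prob_space (uniform_measure surface_measure (Sp i h \<inter> Sc i h))"
      by (intro prob_space_uniform_measure) (auto simp: s.emeasure_eq_measure)
    with False show ?thesis
      by (auto simp: game_kernel_def intro!: prob_space.prob_space_distr)
  qed
  show ?thesis
  proof (rule Ionescu_Tulcea.intro)
    fix i :: nat
    let ?H = "PiM {0..<i} (\<lambda>_. borel :: 'a measure)"
    show "game_kernel \<epsilon> x0 Sp Sc i \<in> measurable ?H (subprob_algebra borel)"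
    proof (cases "i = 0")
      case True
      then show ?thesis
        by (simp add: game_kernel_def[abs_def] measurable_const space_subprob_algebra
             prob_space_imp_subprob_space prob_space_return)
    next
      case False
      have g: "Sigma (space ?H) (Sp i) \<in> sets (?H \<Otimes>\<^sub>M borel)" "Sigma (space ?H) (Sc i) \<in> sets (?H \<Otimes>\<^sub>M borel)"
        using S False by (auto simp: strategies_def)
      have AB: "Sp i h \<in> sets borel" "Sc i h \<in> sets borel" if "h \<in> space ?H" for h
        using S False that by (auto simp: strategies_def admissible_sets_def)
      have em: "(\<lambda>h. emeasure surface_measure (Sp i h \<inter> Sc i h \<inter> {v. h (i - 1) + \<epsilon> *\<^sub>R v \<in> E})) \<in> borel_measurable ?H"
        if E[measurable]: "E \<in> sets borel" for E
      proof -
        have [measurable]: "i - 1 \<in> {0..<i}" using False by auto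
        have 1: "{p \<in> space (?H \<Otimes>\<^sub>M borel). fst p (i - 1) + \<epsilon> *\<^sub>R snd p \<in> E} \<in> sets (?H \<Otimes>\<^sub>M borel)"
          by measurable
        let ?Q = "Sigma (space ?H) (Sp i) \<inter> Sigma (space ?H) (Sc i) \<inter> {p \<in> space (?H \<Otimes>\<^sub>M borel). fst p (i - 1) + \<epsilon> *\<^sub>R snd p \<in> E}"
        have "?Q \<in> sets (?H \<Otimes>\<^sub>M surface_measure)"
          using g 1 by (simp cong: sets_pair_measure_cong)
        from s.measurable_emeasure_Pair[OF this] show ?thesis
          by (rule measurable_cong[THEN iffD1, rotated])
             (auto intro!: arg_cong2[where f=emeasure] simp: space_pair_measure)
      qed
      show ?thesis
      proof (rule measurable_subprob_algebra)
        fix h assume h: "h \<in> space ?H"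
        show "subprob_space (game_kernel \<epsilon> x0 Sp Sc i h)"
          by (rule prob_space_imp_subprob_space) (rule prob[OF h])
        show "sets (game_kernel \<epsilon> x0 Sp Sc i h) = sets borel"
          using False by (simp add: game_kernel_def)
      next
        fix E :: "'a set" assume E: "E \<in> sets borel"
        have "emeasure (game_kernel \<epsilon> x0 Sp Sc i h) E =
           emeasure surface_measure (Sp i h \<inter> Sc i h \<inter> {v. h (i - 1) + \<epsilon> *\<^sub>R v \<in> E}) / 
           emeasure surface_measure (Sp i h \<inter> Sc i h \<inter> {v. h (i - 1) + \<epsilon> *\<^sub>R v \<in> UNIV})"
          if h: "h \<in> space ?H" for h
        proof -
          have "{v. h (i - 1) + \<epsilon> *\<^sub>R v \<in> E} = (\<lambda>v. h (i - 1) + \<epsilon> *\<^sub>R v) -` E \<inter> space borel" by auto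
          also have "\<dots> \<in> sets borel" by (rule measurable_sets[OF _ E]) measurable
          finally show ?thesis
          using False E AB[OF h] by (simp add: game_kernel_def emeasure_distr vimage_def)
        qed
        moreover have "(\<lambda>h.
           emeasure surface_measure (Sp i h \<inter> Sc i h \<inter> {v. h (i - 1) + \<epsilon> *\<^sub>R v \<in> E}) /
           emeasure surface_measure (Sp i h \<inter> Sc i h \<inter> {v. h (i - 1) + \<epsilon> *\<^sub>R v \<in> UNIV}))
           \<in> borel_measurable ?H"
          by (intro borel_measurable_divide_ennreal em E) simp
        ultimately show "(\<lambda>h. emeasure (game_kernel \<epsilon> x0 Sp Sc i h) E) \<in> borel_measurable ?H"
          by (simp cong: measurable_cong)
      qed
    qed
  qed (rule prob)
qed

text \<open>
  The law of the whole sequence of positions, from the Ionescu-Tulcea theorem. The sequence is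
  continued after the exit from the domain; only the positions up to the exit enter the payoff.
\<close>

definition game_measure ::
  "real \<Rightarrow> 'a::euclidean_space \<Rightarrow> (nat \<Rightarrow> (nat \<Rightarrow> 'a) \<Rightarrow> 'a set) \<Rightarrow>
   (nat \<Rightarrow> (nat \<Rightarrow> 'a) \<Rightarrow> 'a set) \<Rightarrow> (nat \<Rightarrow> 'a) measure" where
  "game_measure \<epsilon> x0 Sp Sc =
     projective_family.lim UNIV (Ionescu_Tulcea.CI (game_kernel \<epsilon> x0 Sp Sc) (\<lambda>_. borel)) (\<lambda>_. borel)"

text \<open>Infinite if the game never ends; zero if the initial position is outside the domain.\<close>

definition number_of_plays :: "'a set \<Rightarrow> (nat \<Rightarrow> 'a) \<Rightarrow> ennreal" where
  "number_of_plays \<Omega> \<omega> =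
     (if \<exists>n. \<omega> n \<notin> \<Omega> then of_nat (LEAST n. \<omega> n \<notin> \<Omega>) else \<infinity>)"

definition expected_payoff ::
  "'a::euclidean_space set \<Rightarrow> real \<Rightarrow> real \<Rightarrow> 'a \<Rightarrow> (nat \<Rightarrow> (nat \<Rightarrow> 'a) \<Rightarrow> 'a set) \<Rightarrow>
   (nat \<Rightarrow> (nat \<Rightarrow> 'a) \<Rightarrow> 'a set) \<Rightarrow> ennreal" where
  "expected_payoff \<Omega> K \<epsilon> x0 Sp Sc =
     (\<integral>\<^sup>+\<omega>. ennreal (\<epsilon>\<^sup>2 * K) * number_of_plays \<Omega> \<omega> \<partial>game_measure \<epsilon> x0 Sp Sc)"

definition paul_value :: "'a::euclidean_space set \<Rightarrow> real \<Rightarrow> real \<Rightarrow> 'a \<Rightarrow> ennreal" where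
  "paul_value \<Omega> K \<epsilon> x0 =
     (INF Sc\<in>strategies \<epsilon>. SUP Sp\<in>strategies \<epsilon>. expected_payoff \<Omega> K \<epsilon> x0 Sp Sc)"

definition carol_value :: "'a::euclidean_space set \<Rightarrow> real \<Rightarrow> real \<Rightarrow> 'a \<Rightarrow> ennreal" where
  "carol_value \<Omega> K \<epsilon> x0 =
     (SUP Sp\<in>strategies \<epsilon>. INF Sc\<in>strategies \<epsilon>. expected_payoff \<Omega> K \<epsilon> x0 Sp Sc)"

text \<open>
  Solutions are sought among the bounded Borel functions, for which the averages make sense
  and the suprema and infima are taken over bounded sets of reals.
\<close>

definition dpp_solution :: "'a::euclidean_space set \<Rightarrow> real \<Rightarrow> real \<Rightarrow> ('a \<Rightarrow> real) \<Rightarrow> bool" where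
  "dpp_solution \<Omega> K \<epsilon> u \<longleftrightarrow>
     u \<in> borel_measurable borel \<and> bounded (range u) \<and>
     (\<forall>x\<in>\<Omega>. u x =
        (SUP A\<in>admissible_sets \<epsilon>. INF B\<in>admissible_sets \<epsilon>.
           1 / measure surface_measure (A \<inter> B) *
             (LINT v : A \<inter> B | surface_measure. u (x + \<epsilon> *\<^sub>R v)))
        + \<epsilon>\<^sup>2 * K) \<and>
     (\<forall>x. x \<notin> \<Omega> \<longrightarrow> u x = 0)"

end

theory Submission
  imports Defs
begin

text \<open>
  A single round already has a saddle point. For a reward \<open>f\<close> on the sphere, let one player take the
  directions with the highest values of \<open>f\<close> and the other those with the lowest, both with the least
  admissible measure. The two sets meet in the middle band of \<open>f\<close>, of measure \<open>2 * sqrt \<epsilon>\<close>, which is the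
  smallest overlap that two admissible sets can have. Neither player gains by deviating: among the subsets of
  the top set with at least this measure the band has the lowest mean, and dually for the bottom set
  (\<open>saddle_sets_best_reply_min\<close>, \<open>saddle_sets_best_reply_max\<close>). So supremum and infimum may be exchanged in
  each round and both are attained. The sets must have exactly the prescribed measure, which requires
  splitting level sets of \<open>f\<close> of positive measure; slices of the sphere by hyperplanes, which are null in
  dimension at least 2, do this. Since the cuts are quantiles, the optimal sets depend measurably on
  the position (\<open>exists_measurable_saddle_sets\<close>), and they define strategies that look only at the current
  position.

  Let \<open>w\<close> be any bounded solution of the dynamic programming equation. Write \<open>p n\<close> for the probability that
  the positions \<open>0, \<dots>, n\<close> all lie in the domain, so that the expected payoff is \<open>\<epsilon>\<^sup>2 * K\<close> times the sum of
  the \<open>p n\<close>. If the minimizing player plays the saddle sets for \<open>w\<close>, the expectation \<open>y n\<close> of \<open>w\<close> at the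
  position \<open>n\<close>, on the event that the game is not over, satisfies \<open>y (n + 1) \<le> y n - \<epsilon>\<^sup>2 * K * p n\<close>. As \<open>\<bar>y n\<bar>\<close>
  is at most a constant times \<open>p n\<close>, the \<open>p n\<close> are summable, \<open>y\<close> tends to zero, and the payoff is at most \<open>w\<close>
  at the initial position. If the maximizing player plays the corresponding sets, the inequality is reversed and the payoff
  is at least that number, or infinite. Hence both values of the game equal \<open>w\<close>
  (\<open>value_eq_dpp_solution\<close>), which proves that the game has a value and that bounded solutions are unique.

  It remains to find one bounded solution (\<open>exists_dpp_solution\<close>). Iterating the equation from zero gives
  an increasing sequence of functions. It is bounded by a concave quadratic function of one linear coordinate,
  which is a supersolution because in that coordinate a step in the middle band has positive second moment and,
  with the right orientation, nonnegative mean (\<open>exists_supersolution\<close>). The limit solves the equation,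
  because the value of a round is Lipschitz in the \<open>L\<^sup>1\<close> norm of the reward (\<open>round_value_lipschitz\<close>).
\<close>

section \<open>Null slices of the sphere\<close>

text \<open>
  For \<open>0 \<le> c\<close> the cone \<open>c * norm x \<le> e \<bullet> x\<close> is convex, and the frontier of a convex set is a
  Lebesgue null set. If \<open>c < 1\<close>, the set in question lies in that frontier. If \<open>c \<ge> 1\<close>, equality in the
  Cauchy-Schwarz inequality confines it to the axis, which is null because the dimension is at least 2.
\<close>

lemma negligible_cone_boundary:
  fixes e :: "'a::euclidean_space"
  assumes dim: "DIM('a) \<ge> 2" and e: "norm e = 1" and c: "0 \<le> c"
  shows "negligible {x. e \<bullet> x = c * norm x}"
proof (cases "c < 1")
  case True
  let ?K = "{x. c * norm x \<le> e \<bullet> x}"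
  have "convex ?K"
  proof (rule convexI)
    fix x y :: 'a and a b :: real
    assume xy: "x \<in> ?K" "y \<in> ?K" and ab: "0 \<le> a" "0 \<le> b" "a + b = 1"
    have "c * norm (a *\<^sub>R x + b *\<^sub>R y) \<le> c * (a * norm x + b * norm y)"
      using ab c by (intro mult_left_mono norm_triangle_le) auto
    also have "\<dots> = a * (c * norm x) + b * (c * norm y)" by (simp add: algebra_simps)
    also have "\<dots> \<le> a * (e \<bullet> x) + b * (e \<bullet> y)"
      using xy ab by (intro add_mono mult_left_mono) auto
    finally show "a *\<^sub>R x + b *\<^sub>R y \<in> ?K" by (simp add: inner_right_distrib)
  qed
  then have "negligible (frontier ?K)" by (rule negligible_convex_frontier)
  moreover have "{x. e \<bullet> x = c * norm x} \<subseteq> frontier ?K"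
  proof
    fix x assume "x \<in> {x. e \<bullet> x = c * norm x}"
    then have x: "e \<bullet> x = c * norm x" by simp
    have "x \<notin> interior ?K"
    proof
      assume "x \<in> interior ?K"
      then obtain r where r: "r > 0" "ball x r \<subseteq> ?K" by (auto simp: mem_interior)
      \<comment> \<open>Moving against the axis lowers \<open>e \<bullet> x\<close> at unit speed but \<open>c * norm x\<close> at most at speed \<open>c\<close>.\<close>
      let ?y = "x - (r/2) *\<^sub>R e"
      have "?y \<in> ball x r" using r e by (simp add: dist_norm)
      then have y: "c * norm ?y \<le> e \<bullet> ?y" using r(2) by (simp only: subset_iff mem_Collect_eq)
      have "norm x - r/2 \<le> norm ?y"
        using norm_triangle_ineq2[of x "(r/2) *\<^sub>R e"] e r by simp
      then have "c * (norm x - r/2) \<le> e \<bullet> ?y" using y c by (meson mult_left_mono order_trans)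
      moreover have "e \<bullet> ?y = c * norm x - r/2"
        using x e by (simp add: inner_diff_right dot_square_norm)
      ultimately have "r/2 \<le> c * (r/2)" by (simp add: algebra_simps)
      with True r show False by (simp add: field_simps)
    qed
    moreover have "x \<in> closure ?K" by (rule subsetD[OF closure_subset]) (simp add: x)
    ultimately show "x \<in> frontier ?K" by (simp add: frontier_def)
  qed
  ultimately show ?thesis by (rule negligible_subset)
next
  case False
  have "x \<in> span {e}" if x: "e \<bullet> x = c * norm x" for x
  proof -
    have "e \<bullet> x \<le> norm x" using norm_cauchy_schwarz[of e x] e by simp
    moreover have "norm x \<le> c * norm x" using False by (simp add: mult_right_mono[of 1 c, simplified])
    ultimately have "e \<bullet> x = norm e * norm x" using x e by simp
    then have "x = norm x *\<^sub>R e" unfolding norm_cauchy_schwarz_eq using e by simp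
    moreover have "norm x *\<^sub>R e \<in> span {e}" by (intro span_mul span_base) simp
    ultimately show ?thesis by simp
  qed
  then have "dim {x. e \<bullet> x = c * norm x} \<le> dim {e}"
    by (intro dim_mono subsetI) auto
  also have "\<dots> \<le> 1" using dim_le_card'[of "{e}"] by simp
  finally show ?thesis using dim by (intro negligible_lowdim) simp
qed

text \<open>
  Linear functionals therefore have no atoms under the surface measure, so they can break ties between
  directions with equal values. In dimension 1 the sphere is a pair of atoms and this fails.
\<close>

lemma emeasure_surface_measure_slice:
  fixes e :: "'a::euclidean_space"
  assumes dim: "DIM('a) \<ge> 2" and e: "norm e = 1"
  shows "emeasure surface_measure {v. e \<bullet> v = c} = 0"
proof -
  let ?Z = "{x. e \<bullet> x = c * norm x}"
  have "negligible ?Z"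
  proof (cases "0 \<le> c")
    case True
    then show ?thesis using negligible_cone_boundary[OF dim e] by simp
  next
    case False
    then have "negligible {x. (- e) \<bullet> x = (- c) * norm x}"
      using e by (intro negligible_cone_boundary[OF dim]) auto
    then show ?thesis by simp
  qed
  moreover have "closed ?Z" by (intro closed_Collect_eq continuous_intros)
  ultimately have "emeasure lborel ?Z = 0"
    by (auto simp: negligible_iff_null_sets null_sets_completion_iff)
  moreover have "emeasure lborel {x \<in> cball 0 1 - {0}. sgn x \<in> {v. e \<bullet> v = c}} \<le> emeasure lborel ?Z"
    using borel_closed[OF \<open>closed ?Z\<close>]
    by (intro emeasure_mono) (auto simp: sgn_div_norm field_simps)
  ultimately have 0: "emeasure lborel {x \<in> cball 0 1 - {0}. sgn x \<in> {v. e \<bullet> v = c}} = 0"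
    by (simp only: le_zero_eq)
  have "{v. e \<bullet> v = c} \<in> sets borel"
    by (intro borel_closed closed_Collect_eq continuous_intros)
  from emeasure_surface_measure[OF this] 0 show ?thesis by simp
qed

section \<open>Measurable quantiles and top sets\<close>

text \<open>
  This is the upper \<open>s\<close>-quantile of \<open>g\<close>, meant for functions with values strictly between \<open>-3\<close> and \<open>3\<close>:
  at most mass \<open>s\<close> lies strictly above it. The cut-off \<open>-3\<close>, below all values of \<open>g\<close>, keeps the infimum
  finite also when \<open>s\<close> is the total mass.
\<close>

definition upper_quantile :: "'v measure \<Rightarrow> ('v \<Rightarrow> real) \<Rightarrow> real \<Rightarrow> real" where
  "upper_quantile M g s = Inf {t. -3 \<le> t \<and> measure M {v\<in>space M. t < g v} \<le> s}"

context finite_measure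
begin

text \<open>
  The mass strictly above a level is right-continuous in the level, so the infimum that defines the
  quantile is attained. The resulting equivalence shows how the quantile depends on a parameter:
  its sublevel sets are described by the measures of sets.
\<close>

lemma upper_quantile_le_iff:
  assumes g[measurable]: "g \<in> borel_measurable M" and ub: "\<And>v. v \<in> space M \<Longrightarrow> g v < 3"
    and s: "0 \<le> s" and r: "-3 \<le> r"
  shows "upper_quantile M g s \<le> r \<longleftrightarrow> measure M {v\<in>space M. r < g v} \<le> s"
proof -
  let ?T = "{t. -3 \<le> t \<and> measure M {v\<in>space M. t < g v} \<le> s}"
  have bdd: "bdd_below ?T" by (rule bdd_belowI[of _ "-3"]) auto
  have "{v\<in>space M. 3 < g v} = {}" using ub by force
  then have ne: "3 \<in> ?T" using s by (simp del: Collect_empty_eq)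
  show ?thesis
  proof
    assume "measure M {v\<in>space M. r < g v} \<le> s"
    then show "upper_quantile M g s \<le> r"
      unfolding upper_quantile_def using r by (intro cInf_lower bdd) auto
  next
    assume q: "upper_quantile M g s \<le> r"
    let ?A = "\<lambda>n. {v\<in>space M. r + 1 / Suc n < g v}"
    have le: "measure M (?A n) \<le> s" for n
    proof -
      have "Inf ?T < r + 1 / Suc n"
        using q by (intro le_less_trans[OF q[unfolded upper_quantile_def]]) auto
      then obtain t where t: "t \<in> ?T" "t < r + 1 / Suc n"
        using cInf_lessD[of ?T] ne by blast
      have "measure M (?A n) \<le> measure M {v\<in>space M. t < g v}"
        using t by (intro finite_measure_mono) auto
      with t show ?thesis by simp
    qed
    have lim: "(\<lambda>n. measure M (?A n)) \<longlonglongrightarrow> measure M (\<Union>n. ?A n)"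
    proof (intro finite_Lim_measure_incseq incseq_SucI)
      fix n
      have "1 / real (Suc (Suc n)) \<le> 1 / Suc n" by (intro divide_left_mono) auto
      then show "?A n \<subseteq> ?A (Suc n)" by auto
    qed auto
    have un: "(\<Union>n. ?A n) = {v\<in>space M. r < g v}"
    proof safe
      fix v assume v: "v \<in> space M" "r < g v"
      then obtain n where "inverse (real (Suc n)) < g v - r"
        using reals_Archimedean[of "g v - r"] by auto
      then have "v \<in> ?A n" using v by (simp add: inverse_eq_divide)
      then show "v \<in> (\<Union>n. ?A n)" by (rule UN_I[OF UNIV_I])
    next
      fix v n assume "r + 1 / Suc n < g v"
      moreover have "0 < 1 / real (Suc n)" by simp
      ultimately show "r < g v" by linarith
    qed
    show "measure M {v\<in>space M. r < g v} \<le> s"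
      by (rule LIMSEQ_le_const2[OF lim[unfolded un]]) (intro exI allI impI le)
  qed
qed

lemma upper_quantile_ge:
  assumes "\<And>v. v \<in> space M \<Longrightarrow> g v < 3" and "0 \<le> s"
  shows "-3 \<le> upper_quantile M g s"
proof -
  have "{v\<in>space M. 3 < g v} = {}" using assms(1) by force
  then have "3 \<in> {t. -3 \<le> t \<and> measure M {v\<in>space M. t < g v} \<le> s}" (is "_ \<in> ?T")
    using assms(2) by (simp del: Collect_empty_eq)
  then have "?T \<noteq> {}" by blast
  then show ?thesis unfolding upper_quantile_def by (rule cInf_greatest) simp
qed

lemma measure_greater_upper_quantile:
  assumes "g \<in> borel_measurable M" and "\<And>v. v \<in> space M \<Longrightarrow> g v < 3" and "0 \<le> s"
  shows "measure M {v\<in>space M. upper_quantile M g s < g v} \<le> s"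
  by (rule upper_quantile_le_iff[OF assms upper_quantile_ge[OF assms(2,3)], THEN iffD1]) auto

text \<open>
  Every level strictly between the cut-off and the quantile has more than mass \<open>s\<close> above it, and the mass is
  continuous from above along levels increasing to the quantile. At the cut-off the set is the whole space.
\<close>

lemma measure_ge_upper_quantile:
  assumes g[measurable]: "g \<in> borel_measurable M" and ub: "\<And>v. v \<in> space M \<Longrightarrow> g v < 3"
    and lb: "\<And>v. v \<in> space M \<Longrightarrow> -3 < g v" and s: "0 \<le> s" "s \<le> measure M (space M)"
  shows "s \<le> measure M {v\<in>space M. upper_quantile M g s \<le> g v}"
proof -
  let ?q = "upper_quantile M g s"
  consider "?q = -3" | "-3 < ?q" using upper_quantile_ge[of g s] ub s by force
  then show ?thesis
  proof cases
    case 1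
    then have "{v\<in>space M. ?q \<le> g v} = space M" using lb by force
    then show ?thesis using s by simp
  next
    case 2
    define d where "d = ?q + 3"
    have d: "d > 0" using 2 by (simp add: d_def)
    let ?A = "\<lambda>n. {v\<in>space M. ?q - d / Suc n < g v}"
    have le: "s \<le> measure M (?A n)" for n
    proof -
      have "d / Suc n \<le> d" using d by (simp add: field_simps)
      then have "-3 \<le> ?q - d / Suc n" by (simp add: d_def)
      moreover have "\<not> ?q \<le> ?q - d / Suc n" using d by (simp add: not_le)
      ultimately show ?thesis using upper_quantile_le_iff[OF g ub s(1)] by (metis linear)
    qed
    have lim: "(\<lambda>n. measure M (?A n)) \<longlonglongrightarrow> measure M (\<Inter>n. ?A n)"
    proof (intro finite_Lim_measure_decseq decseq_SucI)
      fix n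
      have "d / Suc (Suc n) \<le> d / Suc n" using d by (intro divide_left_mono) auto
      then show "?A (Suc n) \<subseteq> ?A n" by auto
    qed auto
    have int: "(\<Inter>n. ?A n) = {v\<in>space M. ?q \<le> g v}"
    proof safe
      fix v assume v: "v \<in> (\<Inter>n. ?A n)"
      show "v \<in> space M" using v by auto
      show "?q \<le> g v"
      proof (rule ccontr)
        assume "\<not> ?q \<le> g v"
        then obtain n where "inverse (real (Suc n)) < (?q - g v) / d"
          using reals_Archimedean[of "(?q - g v) / d"] d by auto
        then have "d / Suc n < ?q - g v" using d by (simp add: field_simps)
        moreover have "?q - d / Suc n < g v" using v by auto
        ultimately show False by simp
      qed
    next
      fix v n assume "?q \<le> g v"
      moreover have "0 < d / Suc n" using d by simp
      ultimately show "?q - d / Suc n < g v" by linarith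
    qed
    show ?thesis
      by (rule LIMSEQ_le_const[OF lim[unfolded int]]) (intro exI allI impI le)
  qed
qed

lemma upper_quantile_antimono:
  assumes "g \<in> borel_measurable M" and "\<And>v. v \<in> space M \<Longrightarrow> g v < 3" and "0 \<le> s" "s \<le> s'"
  shows "upper_quantile M g s' \<le> upper_quantile M g s"
proof -
  have "measure M {v\<in>space M. upper_quantile M g s < g v} \<le> s'"
    using measure_greater_upper_quantile[OF assms(1-3)] assms(4) by linarith
  then show ?thesis
    using upper_quantile_le_iff[OF assms(1,2) _ upper_quantile_ge[OF assms(2,3)]] assms(3,4) by simp
qed

lemma measurable_upper_quantile:
  assumes g[measurable]: "case_prod g \<in> borel_measurable (N \<Otimes>\<^sub>M M)"
    and ub: "\<And>x v. x \<in> space N \<Longrightarrow> v \<in> space M \<Longrightarrow> g x v < 3" and s: "0 \<le> s"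
  shows "(\<lambda>x. upper_quantile M (g x) s) \<in> borel_measurable N"
proof (rule borel_measurableI_le)
  fix r
  have m: "g x \<in> borel_measurable M" if "x \<in> space N" for x
    using that by measurable
  show "{x \<in> space N. upper_quantile M (g x) s \<le> r} \<in> sets N"
  proof (cases "-3 \<le> r")
    case True
    have "(\<lambda>x. emeasure M (Pair x -` {p \<in> space (N \<Otimes>\<^sub>M M). r < case_prod g p})) \<in> borel_measurable N"
      by (rule measurable_emeasure_Pair) measurable
    then have "(\<lambda>x. emeasure M {v \<in> space M. r < g x v}) \<in> borel_measurable N"
      by (rule measurable_cong[THEN iffD1, rotated])
         (auto intro!: arg_cong2[where f=emeasure] simp: space_pair_measure)
    then have [measurable]: "(\<lambda>x. measure M {v \<in> space M. r < g x v}) \<in> borel_measurable N"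
      unfolding measure_def by measurable
    have "{x \<in> space N. upper_quantile M (g x) s \<le> r}
        = {x \<in> space N. measure M {v \<in> space M. r < g x v} \<le> s}"
      using upper_quantile_le_iff[OF m ub s True] by blast
    then show ?thesis by simp
  next
    case False
    then have "{x \<in> space N. upper_quantile M (g x) s \<le> r} = {}"
      using upper_quantile_ge[of "g _" s] ub s by force
    then show ?thesis by (simp only: sets.empty_sets)
  qed
qed

text \<open>
  The set \<open>D s x\<close> consists of the points that come first, up to mass exactly \<open>s\<close>, when \<open>M\<close> is ordered by
  decreasing \<open>f x\<close>. A level of \<open>f x\<close> may carry positive mass, so that no superlevel set need have mass
  \<open>s\<close>; then the level at the quantile is itself split along the levels of \<open>h\<close>, which are null. Both cuts
  are quantiles and hence measurable in \<open>x\<close>. Passing from a function to its arctangent changes no order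
  and brings all values into the range required of quantiles.
\<close>

lemma exists_measurable_top_sets:
  fixes f :: "'x \<Rightarrow> 'a \<Rightarrow> real"
  assumes f[measurable]: "case_prod f \<in> borel_measurable (N \<Otimes>\<^sub>M M)"
    and h[measurable]: "h \<in> borel_measurable M"
    and null: "\<And>c. measure M {v\<in>space M. h v = (c::real)} = 0"
  obtains D :: "real \<Rightarrow> 'x \<Rightarrow> 'a set" where
    "\<And>s. 0 \<le> s \<Longrightarrow> Sigma (space N) (D s) \<in> sets (N \<Otimes>\<^sub>M M)"
    "\<And>s x. 0 \<le> s \<Longrightarrow> x \<in> space N \<Longrightarrow> D s x \<in> sets M"
    "\<And>s x. 0 \<le> s \<Longrightarrow> s \<le> measure M (space M) \<Longrightarrow> x \<in> space N \<Longrightarrow> measure M (D s x) = s"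
    "\<And>s x a b. a \<in> D s x \<Longrightarrow> b \<in> space M - D s x \<Longrightarrow> f x b \<le> f x a"
    "\<And>s s' x. 0 \<le> s \<Longrightarrow> s \<le> s' \<Longrightarrow> s' \<le> measure M (space M) \<Longrightarrow> x \<in> space N \<Longrightarrow> D s x \<subseteq> D s' x"
proof -
  have arctan: "-2 < arctan y" "arctan y < 2" for y :: real
    using arctan_lbound[of y] arctan_ubound[of y] pi_less_4 by auto
  define F where "F x v = arctan (f x v)" for x v
  define t where "t s x = upper_quantile M (F x) s" for s x
  \<comment> \<open>The three branches are the points above, at and below the first cut.
    The outer values \<open>2\<close> and \<open>-2\<close> lie beyond the range of arctan.\<close>
  define G where "G s x v = (if t s x < F x v then 2 else if F x v = t s x then arctan (h v) else -2)" for s x v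
  define c where "c s x = upper_quantile M (G s x) s" for s x
  define D where "D s x = {v\<in>space M. c s x < G s x v}" for s x
  have F: "-3 < F x v" "F x v < 3" for x v
    using arctan[of "f x v"] by (auto simp: F_def)
  have G: "-2 \<le> G s x v" "G s x v \<le> 2" for s x v
    using arctan[of "h v"] by (auto simp: G_def)
  have G3: "-3 < G s x v" "G s x v < 3" for s x v
    using G[of s x v] by auto
  have [measurable]: "case_prod F \<in> borel_measurable (N \<Otimes>\<^sub>M M)"
    unfolding F_def by measurable
  have t[measurable]: "t s \<in> borel_measurable N" if "0 \<le> s" for s
    unfolding t_def by (rule measurable_upper_quantile) (auto intro: F that)
  have mG[measurable]: "case_prod (G s) \<in> borel_measurable (N \<Otimes>\<^sub>M M)" if [simp]: "0 \<le> s" for s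
  proof -
    note [measurable] = t[OF that]
    show ?thesis unfolding G_def by measurable
  qed
  have c: "c s \<in> borel_measurable N" if "0 \<le> s" for s
    unfolding c_def by (rule measurable_upper_quantile) (auto intro: G3 mG that)
  have Fx[measurable]: "F x \<in> borel_measurable M" if "x \<in> space N" for x
    using that by measurable
  have Gx: "G s x \<in> borel_measurable M" if x[measurable]: "x \<in> space N" and s: "0 \<le> s" for s x
  proof -
    note [measurable] = mG[OF s]
    show ?thesis by measurable
  qed
  \<comment> \<open>Since \<open>19/10\<close> lies between \<open>pi/2\<close> and \<open>2\<close>,
    \<open>G s x\<close> exceeds it only above the first cut, on a set of mass at most \<open>s\<close>.\<close>
  have c_le: "c s x \<le> 19/10" if x: "x \<in> space N" and s: "0 \<le> s" for s x
  proof -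
    have "19/10 < G s x v \<longleftrightarrow> t s x < F x v" for v
      using arctan_ubound[of "h v"] pi_approx by (simp add: G_def)
    then have "measure M {v \<in> space M. 19/10 < G s x v} \<le> s"
      using measure_greater_upper_quantile[of "F x" s] Fx[OF x] F s by (simp add: t_def)
    then show ?thesis
      unfolding c_def by (subst upper_quantile_le_iff[OF Gx[OF x s] G3(2) s]) simp_all
  qed
  have D_sets: "D s x \<in> sets M" if x: "x \<in> space N" and s: "0 \<le> s" for s x
  proof -
    note [measurable] = Gx[OF x s]
    show ?thesis unfolding D_def by measurable
  qed
  have D_all: "D s x = space M" if "c s x < -2" for s x
    using less_le_trans[OF that G(1)] by (auto simp: D_def)
  have D_le: "measure M (D s x) \<le> s" if "x \<in> space N" "0 \<le> s" for s x
    unfolding D_def c_def using Gx that by (intro measure_greater_upper_quantile G3)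
  have D_meas: "measure M (D s x) = s"
    if x: "x \<in> space N" and s: "0 \<le> s" and s': "s \<le> measure M (space M)" for s x
  proof -
    note [measurable] = Gx[OF x s] Fx[OF x]
    \<comment> \<open>If the second cut is below \<open>-2\<close> everything is kept; at \<open>-2\<close>
      the whole level of the first cut is kept; above \<open>-2\<close> it is a level of \<open>h\<close>,
      whose mass is zero.\<close>
    consider "c s x < -2" | "c s x = -2" | "-2 < c s x" by linarith
    then have "s \<le> measure M (D s x)"
    proof cases
      case 1
      then have "D s x = space M" by (intro D_all) simp
      with s' show ?thesis by simp
    next
      case 2
      have "s \<le> measure M {v\<in>space M. t s x \<le> F x v}"
        unfolding t_def using F s s' by (intro measure_ge_upper_quantile) auto
      also have "{v\<in>space M. t s x \<le> F x v} = D s x"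
        using arctan(1) by (auto simp: D_def G_def 2 split: if_splits)
      finally show ?thesis .
    next
      case 3
      have "s \<le> measure M {v\<in>space M. c s x \<le> G s x v}"
        unfolding c_def using G3 s s' by (intro measure_ge_upper_quantile) auto
      also have "\<dots> \<le> measure M (D s x \<union> {v\<in>space M. h v = tan (c s x)})"
      proof (intro finite_measure_mono sets.Un D_sets x s)
        show "{v \<in> space M. c s x \<le> G s x v} \<subseteq> D s x \<union> {v \<in> space M. h v = tan (c s x)}"
        proof
          fix v assume v: "v \<in> {v \<in> space M. c s x \<le> G s x v}"
          show "v \<in> D s x \<union> {v \<in> space M. h v = tan (c s x)}"
          proof (cases "G s x v = c s x")
            case True
            then have "arctan (h v) = c s x"
              using 3 c_le[OF x s] by (auto simp: G_def split: if_splits)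
            then have "h v = tan (c s x)" using tan_arctan[of "h v"] by simp
            with v show ?thesis by auto
          qed (use v in \<open>auto simp: D_def\<close>)
        qed
      qed measurable
      also have "\<dots> \<le> measure M (D s x) + measure M {v\<in>space M. h v = tan (c s x)}"
        by (intro measure_Un_le D_sets x s) measurable
      finally show ?thesis using null by simp
    qed
    with D_le[OF x s] show ?thesis by simp
  qed
  show ?thesis
  proof
    fix s :: real assume s: "0 \<le> s"
    note [measurable] = mG[OF s] c[OF s]
    have "Sigma (space N) (D s) = {p \<in> space (N \<Otimes>\<^sub>M M). c s (fst p) < G s (fst p) (snd p)}"
      by (auto simp: D_def space_pair_measure)
    also have "\<dots> \<in> sets (N \<Otimes>\<^sub>M M)" by measurable
    finally show "Sigma (space N) (D s) \<in> sets (N \<Otimes>\<^sub>M M)" .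
  next
    fix s x a b assume "a \<in> D s x" "b \<in> space M - D s x"
    then have "G s x b < G s x a" by (auto simp: D_def)
    then have "F x b \<le> F x a"
      using arctan[of "h a"] arctan[of "h b"] by (auto simp: G_def split: if_splits)
    then show "f x b \<le> f x a" by (simp add: F_def arctan_le_iff)
  next
    fix s s' x
    assume s: "0 \<le> s" "s \<le> s'" and s': "s' \<le> measure M (space M)" and x: "x \<in> space N"
    have tt: "t s' x \<le> t s x"
      unfolding t_def using F s Fx[OF x] by (intro upper_quantile_antimono) auto
    show "D s x \<subseteq> D s' x"
    proof (cases "t s' x = t s x")
      case True
      then have "G s' x = G s x" by (auto simp: G_def)
      moreover from this have "c s' x \<le> c s x"
        unfolding c_def using G3 s Gx[OF x s(1)] by (auto intro: upper_quantile_antimono)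
      ultimately show ?thesis by (auto simp: D_def)
    next
      case False
      have "-2 \<le> c s x"
      proof (rule ccontr)
        assume "\<not> -2 \<le> c s x"
        then have "D s x = space M" by (intro D_all) simp
        then have "s = s'" using D_le[OF x s(1)] s s' by simp
        with False show False by simp
      qed
      then have "t s x \<le> F x v" if "v \<in> D s x" for v
        using that by (auto simp: D_def G_def split: if_splits)
      then have "G s' x v = 2" if "v \<in> D s x" for v
        using that tt False by (force simp: G_def)
      moreover have "c s' x < 2" using c_le[OF x, of s'] s by simp
      ultimately show ?thesis by (auto simp: D_def)
    qed
  qed (auto intro: D_sets D_meas)
qed

end

section \<open>Means over sets\<close>

definition mean_on :: "'v measure \<Rightarrow> 'v set \<Rightarrow> ('v \<Rightarrow> real) \<Rightarrow> real" where
  "mean_on M A f = 1 / measure M A * (LINT v:A|M. f v)"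

context finite_measure
begin

lemma integrable_bounded:
  assumes "f \<in> borel_measurable M" "\<And>v. \<bar>f v\<bar> \<le> (C::real)"
  shows "integrable M f"
  using assms by (intro integrable_const_bound[where B=C]) auto

lemma mean_on_diff_const:
  assumes "f \<in> borel_measurable M" "\<And>v. \<bar>f v\<bar> \<le> C" "A \<in> sets M" "0 < measure M A"
  shows "mean_on M A (\<lambda>v. f v - c) = mean_on M A f - c"
proof -
  have "set_integrable M A f" "set_integrable M A (\<lambda>_. c)"
    unfolding set_integrable_def using assms(3)
    by (intro integrable_mult_indicator integrable_bounded[OF assms(1,2)] integrable_const; simp)+
  then show ?thesis
    using assms(3,4) by (simp add: mean_on_def set_integral_diff set_integral_const field_simps
        set_integrable_def set_lebesgue_integral_def emeasure_eq_measure)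
qed

lemma mean_on_uminus: "mean_on M A (\<lambda>v. - f v) = - mean_on M A f"
  by (simp add: mean_on_def set_lebesgue_integral_def)

lemma mean_on_mono:
  assumes "f \<in> borel_measurable M" "\<And>v. \<bar>f v\<bar> \<le> C" "g \<in> borel_measurable M" "\<And>v. \<bar>g v\<bar> \<le> C"
    "A \<in> sets M" "\<And>v. v \<in> A \<Longrightarrow> f v \<le> g v"
  shows "mean_on M A f \<le> mean_on M A g"
  unfolding mean_on_def set_lebesgue_integral_def
proof (intro mult_left_mono integral_mono)
  show "integrable M (\<lambda>v. indicator A v *\<^sub>R f v)" "integrable M (\<lambda>v. indicator A v *\<^sub>R g v)"
    using assms(5) integrable_bounded[OF assms(1,2)] integrable_bounded[OF assms(3,4)]
    by (intro integrable_mult_indicator; simp)+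
qed (use assms in \<open>auto simp: indicator_def\<close>)

lemma abs_mean_on_le:
  assumes "f \<in> borel_measurable M" "\<And>v. \<bar>f v\<bar> \<le> C" "A \<in> sets M" "0 < measure M A"
  shows "\<bar>mean_on M A f\<bar> \<le> C"
proof -
  have c: "mean_on M A (\<lambda>_. c) = c" for c
    using assms(3,4) by (simp add: mean_on_def set_lebesgue_integral_def emeasure_eq_measure)
  have C: "0 \<le> C" using abs_ge_zero assms(2) order_trans by blast
  have "f v \<le> C" "- C \<le> f v" for v
    using assms(2)[of v] by (auto simp: abs_le_iff)
  then have "mean_on M A f \<le> mean_on M A (\<lambda>_. C)" "mean_on M A (\<lambda>_. -C) \<le> mean_on M A f"
    using assms C by (auto intro!: mean_on_mono[where C=C])
  then show ?thesis by (simp add: c abs_le_iff)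
qed

text \<open>
  Suppose that \<open>A \<inter> B\<close> is the part of \<open>A\<close> on which \<open>f\<close> is lowest, and subtract from \<open>f\<close> the threshold \<open>\<tau>\<close>
  between \<open>A \<inter> B\<close> and \<open>A - B\<close>. The difference is nonpositive on \<open>A \<inter> B\<close> and nonnegative on \<open>A - B\<close>, so its
  integral over \<open>A \<inter> B\<close> is the least over all subsets of \<open>A\<close>. Since this integral is nonpositive, dividing
  it by the smaller measure keeps it below.
\<close>

lemma mean_on_lowest_part_le:
  assumes f: "f \<in> borel_measurable M" and C: "\<And>v. \<bar>f v\<bar> \<le> C"
    and sets: "A \<in> sets M" "B \<in> sets M" "B' \<in> sets M"
    and pos: "0 < measure M (A \<inter> B)" and le: "measure M (A \<inter> B) \<le> measure M (A \<inter> B')"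
    and ord: "\<And>a b. a \<in> A - B \<Longrightarrow> b \<in> A \<inter> B \<Longrightarrow> f b \<le> f a"
  shows "mean_on M (A \<inter> B) f \<le> mean_on M (A \<inter> B') f"
proof -
  define \<tau> where "\<tau> = Sup (f ` (A \<inter> B))"
  have ne: "A \<inter> B \<noteq> {}" using pos by auto
  have bdd: "bdd_above (f ` (A \<inter> B))" 
    by (rule bdd_aboveI[of _ C]) (use C in \<open>auto simp: abs_le_iff\<close>)
  have lo: "f v \<le> \<tau>" if "v \<in> A \<inter> B" for v
    unfolding \<tau>_def using that bdd by (intro cSup_upper) auto
  have hi: "\<tau> \<le> f v" if "v \<in> A - B" for v
    unfolding \<tau>_def using ne ord[OF that] by (intro cSup_least) auto
  define g where "g v = f v - \<tau>" for v
  have g: "g \<in> borel_measurable M" unfolding g_def using f by simp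
  have g_bd: "\<bar>g v\<bar> \<le> C + \<bar>\<tau>\<bar>" for v unfolding g_def using C[of v] by linarith
  let ?l = "measure M (A \<inter> B)" and ?l' = "measure M (A \<inter> B')"
  let ?I = "LINT v:A\<inter>B|M. g v" and ?I' = "LINT v:A\<inter>B'|M. g v"
  have int: "integrable M (\<lambda>v. indicator S v *\<^sub>R g v)" if "S \<in> sets M" for S
    using that integrable_bounded[OF g g_bd] by (intro integrable_mult_indicator)
  have "?I \<le> ?I'"
    unfolding set_lebesgue_integral_def
    using lo hi by (intro integral_mono int) (auto simp: sets g_def indicator_def)
  have "?I \<le> 0"
    unfolding set_lebesgue_integral_def
    using integral_mono[OF int[of "A \<inter> B"] integrable_zero] lo sets by (simp add: g_def indicator_def)
  have "?I / ?l \<le> ?I / ?l'"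
    using \<open>?I \<le> 0\<close> pos le by (intro divide_left_mono_neg) auto
  also have "\<dots> \<le> ?I' / ?l'"
    using \<open>?I \<le> ?I'\<close> by (intro divide_right_mono) auto
  finally have "mean_on M (A \<inter> B) g \<le> mean_on M (A \<inter> B') g" by (simp add: mean_on_def)
  moreover have "mean_on M (A \<inter> B) g = mean_on M (A \<inter> B) f - \<tau>" "mean_on M (A \<inter> B') g = mean_on M (A \<inter> B') f - \<tau>"
    unfolding g_def using sets pos le by (auto intro!: mean_on_diff_const f C)
  ultimately show ?thesis by simp
qed

end

section \<open>The saddle point of a round\<close>

interpretation surf: finite_measure "surface_measure :: 'a::euclidean_space measure"
  by (rule finite_measure_surface_measure)

text \<open>
  Optimal moves in a single round with reward \<open>f\<close>. The set \<open>A\<close> takes the directions where \<open>f\<close> is high, \<open>B\<close>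
  those where it is low, and they overlap in the least possible measure; the overlap is a middle band of
  values of \<open>f\<close>.
\<close>

definition saddle_sets :: "real \<Rightarrow> ('a::euclidean_space \<Rightarrow> real) \<Rightarrow> 'a set \<Rightarrow> 'a set \<Rightarrow> bool" where
  "saddle_sets \<epsilon> f A B \<longleftrightarrow> A \<in> admissible_sets \<epsilon> \<and> B \<in> admissible_sets \<epsilon> \<and>
     measure surface_measure (A \<inter> B) = 2 * sqrt \<epsilon> \<and>
     (\<forall>a\<in>A - B. \<forall>b\<in>A \<inter> B. f b \<le> f a) \<and> (\<forall>a\<in>A \<inter> B. \<forall>b\<in>B - A. f b \<le> f a)"

lemma admissible_sets_borel: "A \<in> admissible_sets \<epsilon> \<Longrightarrow> A \<in> sets borel"
  by (simp add: admissible_sets_def)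

lemma admissible_Int_pos:
  assumes "\<epsilon> > 0" "A \<in> admissible_sets \<epsilon>" "B \<in> admissible_sets \<epsilon>"
  shows "0 < measure surface_measure (A \<inter> B)"
  using admissible_Int[OF assms] assms(1) real_sqrt_gt_zero[of \<epsilon>] by linarith

lemma saddle_sets_uminus: "saddle_sets \<epsilon> f A B \<Longrightarrow> saddle_sets \<epsilon> (\<lambda>v. - f v) B A"
  by (auto simp: saddle_sets_def Int_commute)

text \<open>
  Any two admissible sets overlap in measure at least \<open>2 * sqrt \<epsilon>\<close>, which is the measure of the middle
  band, and the band is the lowest part of \<open>A\<close>. So no reply to \<open>A\<close> is better for the minimizing player
  than \<open>B\<close>.
\<close>

lemma saddle_sets_best_reply_min:
  fixes f :: "'a::euclidean_space \<Rightarrow> real"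
  assumes "\<epsilon> > 0" and f: "f \<in> borel_measurable borel" "\<And>v. \<bar>f v\<bar> \<le> C"
    and s: "saddle_sets \<epsilon> f A B" and B': "B' \<in> admissible_sets \<epsilon>"
  shows "mean_on surface_measure (A \<inter> B) f \<le> mean_on surface_measure (A \<inter> B') f"
proof (rule surf.mean_on_lowest_part_le)
  show "0 < measure surface_measure (A \<inter> B)"
    using s assms(1) by (auto simp: saddle_sets_def)
  show "measure surface_measure (A \<inter> B) \<le> measure surface_measure (A \<inter> B')"
    using s admissible_Int[OF assms(1) _ B'] by (auto simp: saddle_sets_def)
qed (use s B' f in \<open>auto simp: saddle_sets_def admissible_sets_borel\<close>)

lemma saddle_sets_best_reply_max:
  fixes f :: "'a::euclidean_space \<Rightarrow> real"
  assumes "\<epsilon> > 0" and f: "f \<in> borel_measurable borel" "\<And>v. \<bar>f v\<bar> \<le> C"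
    and s: "saddle_sets \<epsilon> f A B" and A': "A' \<in> admissible_sets \<epsilon>"
  shows "mean_on surface_measure (A' \<inter> B) f \<le> mean_on surface_measure (A \<inter> B) f"
  using saddle_sets_best_reply_min[OF assms(1) _ _ saddle_sets_uminus[OF s] A', of C] f
  by (simp add: surf.mean_on_uminus Int_commute)

definition round_value :: "real \<Rightarrow> ('a::euclidean_space \<Rightarrow> real) \<Rightarrow> real" where
  "round_value \<epsilon> f =
     (SUP A\<in>admissible_sets \<epsilon>. INF B\<in>admissible_sets \<epsilon>. mean_on surface_measure (A \<inter> B) f)"

text \<open>
  A saddle point turns the supremum of infima into an attained value: \<open>A\<close> guarantees the mean over the
  band and \<open>B\<close> keeps every other choice below it. Boundedness of \<open>f\<close> is what makes the real infima
  meaningful.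
\<close>

lemma round_value_eq_saddle:
  fixes f :: "'a::euclidean_space \<Rightarrow> real"
  assumes eps: "\<epsilon> > 0" and f: "f \<in> borel_measurable borel" "\<And>v. \<bar>f v\<bar> \<le> C"
    and s: "saddle_sets \<epsilon> f A B"
  shows "round_value \<epsilon> f = mean_on surface_measure (A \<inter> B) f"
proof -
  let ?m = "\<lambda>A B. mean_on surface_measure (A \<inter> B) f"
  have AB: "A \<in> admissible_sets \<epsilon>" "B \<in> admissible_sets \<epsilon>"
    using s by (auto simp: saddle_sets_def)
  have bd: "\<bar>?m A' B'\<bar> \<le> C" if "A' \<in> admissible_sets \<epsilon>" "B' \<in> admissible_sets \<epsilon>" for A' B'
    using that f admissible_Int_pos[OF eps that]
    by (intro surf.abs_mean_on_le) (auto simp: admissible_sets_borel)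
  have bdd: "bdd_below (?m A' ` admissible_sets \<epsilon>)" if "A' \<in> admissible_sets \<epsilon>" for A'
    using bd[OF that] by (intro bdd_belowI[of _ "-C"]) (auto simp: abs_le_iff minus_le_iff)
  show ?thesis
    unfolding round_value_def
  proof (rule cSup_eq_maximum)
    have "(INF B'\<in>admissible_sets \<epsilon>. ?m A B') = ?m A B"
      using AB saddle_sets_best_reply_min[OF eps f s] by (intro cInf_eq_minimum) auto
    then show "?m A B \<in> (\<lambda>A'. INF B'\<in>admissible_sets \<epsilon>. ?m A' B') ` admissible_sets \<epsilon>"
      using AB by force
  next
    fix y assume "y \<in> (\<lambda>A'. INF B'\<in>admissible_sets \<epsilon>. ?m A' B') ` admissible_sets \<epsilon>"
    then obtain A' where A': "A' \<in> admissible_sets \<epsilon>" "y = (INF B'\<in>admissible_sets \<epsilon>. ?m A' B')"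
      by auto
    have "y \<le> ?m A' B" unfolding A'(2) using bdd[OF A'(1)] AB by (intro cINF_lower)
    also have "\<dots> \<le> ?m A B" by (rule saddle_sets_best_reply_max[OF eps f s A'(1)])
    finally show "y \<le> ?m A B" .
  qed
qed

lemma measure_surface_measure_Int_sphere:
  fixes S :: "'a::euclidean_space set"
  assumes "S \<in> sets borel"
  shows "measure surface_measure (sphere 0 1 \<inter> S) = measure surface_measure S"
proof (rule measure_eq_AE)
  have "- sphere 0 1 \<in> sets (borel :: 'a measure)"
    by (intro borel_open open_Compl closed_sphere)
  then have "- sphere 0 1 \<in> null_sets (surface_measure :: 'a measure)"
    by (simp add: null_sets_def surface_measure_off_sphere)
  from AE_not_in[OF this] show "AE v in surface_measure. (v \<in> sphere 0 1 \<inter> S) = (v \<in> S)" by eventually_elim auto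
qed (use assms in auto)

text \<open>
  With \<open>T\<close> the total surface measure and \<open>m\<close> the least admissible measure, \<open>A\<close> is the top part of measure
  \<open>m\<close> and \<open>B\<close> the complement of the top part of measure \<open>T - m\<close>. Both have measure \<open>m\<close>, and as the top
  parts are nested, the overlap has measure exactly \<open>m - (T - m) = 2 * sqrt \<epsilon>\<close>.
\<close>

lemma exists_measurable_saddle_sets:
  fixes f :: "'x \<Rightarrow> 'a::euclidean_space \<Rightarrow> real"
  assumes dim: "DIM('a) \<ge> 2" and eps: "\<epsilon> > 0" and ne: "(admissible_sets \<epsilon> :: 'a set set) \<noteq> {}"
    and f: "case_prod f \<in> borel_measurable (N \<Otimes>\<^sub>M borel)"
  obtains A B :: "'x \<Rightarrow> 'a set" where
    "Sigma (space N) A \<in> sets (N \<Otimes>\<^sub>M borel)" "Sigma (space N) B \<in> sets (N \<Otimes>\<^sub>M borel)"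
    "\<And>x. x \<in> space N \<Longrightarrow> saddle_sets \<epsilon> (f x) (A x) (B x)"
proof -
  let ?S = "sphere 0 1 :: 'a set" and ?\<mu> = "measure (surface_measure :: 'a measure)"
  define T where "T = ?\<mu> ?S"
  define m where "m = 1/2 * T + sqrt \<epsilon>"
  obtain e :: 'a where e: "norm e = 1" using vector_choose_size[of 1] by auto
  have S[measurable]: "?S \<in> sets borel" by (intro borel_closed closed_sphere)
  have T: "T = ?\<mu> UNIV" using measure_surface_measure_Int_sphere[of UNIV] by (simp add: T_def)
  obtain A0 :: "'a set" where A0: "A0 \<in> admissible_sets \<epsilon>" using ne by blast
  have "?\<mu> A0 \<le> T"
    unfolding T_def using A0 by (intro surf.finite_measure_mono) (auto simp: admissible_sets_def)
  with A0 have m: "m \<le> T" by (simp add: admissible_sets_def m_def T_def)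
  have m': "0 \<le> T - m" "T - m \<le> m" "0 \<le> m"
    using m eps by (auto simp: m_def T_def)
  have sN: "sets (N \<Otimes>\<^sub>M surface_measure) = sets (N \<Otimes>\<^sub>M (borel :: 'a measure))"
    by (intro sets_pair_measure_cong) auto
  have f': "case_prod f \<in> borel_measurable (N \<Otimes>\<^sub>M surface_measure)"
    using f by (simp cong: measurable_cong_sets add: measurable_cong_sets[OF sN refl])
  have null: "?\<mu> {v \<in> space surface_measure. e \<bullet> v = c} = 0" for c
    using emeasure_surface_measure_slice[OF dim e, of c] by (simp add: measure_def)
  have "(\<lambda>v. e \<bullet> v) \<in> borel_measurable surface_measure" by simp
  from surf.exists_measurable_top_sets[OF f' this null] obtain D :: "real \<Rightarrow> 'x \<Rightarrow> 'a set" where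
    D_Sigma: "\<And>s. 0 \<le> s \<Longrightarrow> Sigma (space N) (D s) \<in> sets (N \<Otimes>\<^sub>M surface_measure)" and
    D_sets: "\<And>s x. 0 \<le> s \<Longrightarrow> x \<in> space N \<Longrightarrow> D s x \<in> sets borel" and
    D_meas: "\<And>s x. 0 \<le> s \<Longrightarrow> s \<le> T \<Longrightarrow> x \<in> space N \<Longrightarrow> ?\<mu> (D s x) = s" and
    D_ord: "\<And>s x a b. a \<in> D s x \<Longrightarrow> b \<notin> D s x \<Longrightarrow> f x b \<le> f x a" and
    D_mono: "\<And>s s' x. 0 \<le> s \<Longrightarrow> s \<le> s' \<Longrightarrow> s' \<le> T \<Longrightarrow> x \<in> space N \<Longrightarrow> D s x \<subseteq> D s' x"
    unfolding T by (auto simp: T)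
  define A where "A x = ?S \<inter> D m x" for x
  define B where "B x = ?S - D (T - m) x" for x
  show ?thesis
  proof
    have "space N \<times> ?S \<in> sets (N \<Otimes>\<^sub>M borel)" by measurable
    moreover have "Sigma (space N) A = space N \<times> ?S \<inter> Sigma (space N) (D m)"
      "Sigma (space N) B = space N \<times> ?S - Sigma (space N) (D (T - m))"
      by (auto simp: A_def B_def)
    ultimately show "Sigma (space N) A \<in> sets (N \<Otimes>\<^sub>M borel)" "Sigma (space N) B \<in> sets (N \<Otimes>\<^sub>M borel)"
      using D_Sigma[of m] D_Sigma[of "T - m"] m' by (auto simp: sN)
  next
    fix x assume x: "x \<in> space N"
    note [measurable] = D_sets[OF m'(1) x] D_sets[OF m'(3) x]
    have SD: "?S \<inter> D (T - m) x \<in> sets surface_measure" "?S \<inter> D m x \<in> sets surface_measure"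
      by (simp_all only: sets_surface_measure) measurable
    have muA: "?\<mu> (A x) = m"
      unfolding A_def using m m' x by (simp add: measure_surface_measure_Int_sphere D_meas)
    have muB: "?\<mu> (B x) = m"
    proof -
      have "B x = ?S - ?S \<inter> D (T - m) x" by (auto simp: B_def)
      then have "?\<mu> (B x) = T - ?\<mu> (?S \<inter> D (T - m) x)"
        using surf.finite_measure_Diff[OF _ SD(1), of ?S] S by (simp add: T_def)
      also have "\<dots> = m" using m m' x by (simp add: measure_surface_measure_Int_sphere D_meas)
      finally show ?thesis .
    qed
    have "A x \<inter> B x = ?S \<inter> D m x - ?S \<inter> D (T - m) x" by (auto simp: A_def B_def)
    moreover have "D (T - m) x \<subseteq> D m x" using D_mono m m' x by auto
    ultimately have "?\<mu> (A x \<inter> B x) = ?\<mu> (?S \<inter> D m x) - ?\<mu> (?S \<inter> D (T - m) x)"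
      using surf.finite_measure_Diff[OF SD(2,1)] by auto
    also have "\<dots> = m - (T - m)" using m m' x by (simp add: measure_surface_measure_Int_sphere D_meas)
    finally have muAB: "?\<mu> (A x \<inter> B x) = 2 * sqrt \<epsilon>" by (simp add: m_def)
    have "A x \<in> sets borel" "B x \<in> sets borel" unfolding A_def B_def by measurable
    with muA muB muAB show "saddle_sets \<epsilon> (f x) (A x) (B x)"
      using D_ord[of _ m x] D_ord[of _ "T - m" x]
      by (auto simp: saddle_sets_def admissible_sets_def T_def m_def A_def B_def)
  qed
qed

section \<open>The value of a round as an operator\<close>

lemma measurable_surface_measure [simp]: "measurable surface_measure N = measurable borel N"
  by (rule measurable_cong_sets) simp_all

locale random_direction_game =
  fixes \<Omega> :: "'a::euclidean_space set" and K \<epsilon> :: real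
  assumes dim: "DIM('a) \<ge> 2" and open_\<Omega>: "open \<Omega>" and bounded_\<Omega>: "bounded \<Omega>"
    and K: "K > 0" and eps: "\<epsilon> > 0" and admissible_ne: "(admissible_sets \<epsilon> :: 'a set set) \<noteq> {}"
begin

lemma \<Omega>_borel[measurable]: "\<Omega> \<in> sets borel"
  using open_\<Omega> by (rule borel_open)

lemma exists_saddle_sets:
  assumes f[measurable]: "f \<in> borel_measurable (borel :: 'a measure)"
  obtains A B where "saddle_sets \<epsilon> f A B"
proof -
  have "(\<lambda>(x, v). f v) \<in> borel_measurable (count_space {()} \<Otimes>\<^sub>M borel)" by measurable
  from exists_measurable_saddle_sets[OF dim eps admissible_ne this] show ?thesis
    using that by (metis singletonI space_count_space)
qed

text \<open>
  Playing the optimal \<open>A\<close> for \<open>f\<close> against the optimal \<open>B'\<close> for \<open>g\<close> bounds the value for \<open>f\<close> from above and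
  the value for \<open>g\<close> from below by means over the same set, whose measure is at least \<open>2 * sqrt \<epsilon>\<close>.
  The resulting bound is by an \<open>L\<^sup>1\<close> distance, which is why mere pointwise convergence suffices
  in the lemma that follows.
\<close>

lemma round_value_lipschitz:
  fixes f g :: "'a \<Rightarrow> real"
  assumes f: "f \<in> borel_measurable borel" "\<And>v. \<bar>f v\<bar> \<le> C"
    and g: "g \<in> borel_measurable borel" "\<And>v. \<bar>g v\<bar> \<le> C"
  shows "round_value \<epsilon> f - round_value \<epsilon> g \<le> 1 / (2 * sqrt \<epsilon>) * (LINT v|surface_measure. \<bar>f v - g v\<bar>)"
proof -
  obtain A B where AB: "saddle_sets \<epsilon> f A B" using exists_saddle_sets f(1) by blast
  obtain A' B' where AB': "saddle_sets \<epsilon> g A' B'" using exists_saddle_sets g(1) by blast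
  have adm: "A \<in> admissible_sets \<epsilon>" "B' \<in> admissible_sets \<epsilon>"
    using AB AB' by (auto simp: saddle_sets_def)
  let ?S = "A \<inter> B'"
  have S: "?S \<in> sets borel" using adm by (auto simp: admissible_sets_borel)
  have l: "2 * sqrt \<epsilon> \<le> measure surface_measure ?S" using admissible_Int[OF eps adm] .
  have int: "integrable surface_measure f" "integrable surface_measure g"
    by (auto intro!: surf.integrable_bounded[where C=C] f g)
  have intS: "integrable surface_measure (\<lambda>v. indicator ?S v *\<^sub>R f v)"
     "integrable surface_measure (\<lambda>v. indicator ?S v *\<^sub>R g v)"
    using S int by (auto intro!: integrable_mult_indicator simp del: real_scaleR_def)
  have "round_value \<epsilon> f \<le> mean_on surface_measure ?S f"
    using round_value_eq_saddle[OF eps f AB] saddle_sets_best_reply_min[OF eps f AB adm(2)] by simp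
  moreover have "mean_on surface_measure ?S g \<le> round_value \<epsilon> g"
    using round_value_eq_saddle[OF eps g AB'] saddle_sets_best_reply_max[OF eps g AB' adm(1)] by simp
  ultimately have "round_value \<epsilon> f - round_value \<epsilon> g \<le> mean_on surface_measure ?S f - mean_on surface_measure ?S g"
    by simp
  also have "\<dots> = 1 / measure surface_measure ?S *
      (LINT v|surface_measure. indicator ?S v *\<^sub>R f v - indicator ?S v *\<^sub>R g v)"
    using intS by (simp add: mean_on_def set_lebesgue_integral_def right_diff_distrib diff_divide_distrib)
  also have "\<dots> \<le> 1 / measure surface_measure ?S * (LINT v|surface_measure. \<bar>f v - g v\<bar>)"
    using intS int
    by (intro mult_left_mono integral_mono) (auto simp: indicator_def intro!: integrable_abs)
  also have "\<dots> \<le> 1 / (2 * sqrt \<epsilon>) * (LINT v|surface_measure. \<bar>f v - g v\<bar>)"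
    using l eps admissible_Int_pos[OF eps adm]
    by (intro mult_right_mono divide_left_mono mult_pos_pos) auto
  finally show ?thesis .
qed

lemma round_value_tendsto:
  fixes f :: "nat \<Rightarrow> 'a \<Rightarrow> real"
  assumes f[measurable]: "\<And>n. f n \<in> borel_measurable borel" and C: "\<And>n v. \<bar>f n v\<bar> \<le> C"
    and lim: "\<And>v. (\<lambda>n. f n v) \<longlonglongrightarrow> g v"
  shows "(\<lambda>n. round_value \<epsilon> (f n)) \<longlonglongrightarrow> round_value \<epsilon> g"
proof -
  have g[measurable]: "g \<in> borel_measurable borel"
    using f lim by (rule borel_measurable_LIMSEQ_real[rotated])
  have gC: "\<bar>g v\<bar> \<le> C" for v
    using LIMSEQ_le_const2[OF tendsto_rabs[OF lim]] C by blast
  let ?d = "\<lambda>n. LINT v|surface_measure. \<bar>f n v - g v\<bar>"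
  have "?d \<longlonglongrightarrow> (LINT v|(surface_measure :: 'a measure). 0)"
  proof (rule integral_dominated_convergence[where w="\<lambda>_. 2 * C"])
    show "AE v in surface_measure. (\<lambda>n. \<bar>f n v - g v\<bar>) \<longlonglongrightarrow> 0"
      using lim by (intro AE_I2 tendsto_rabs_zero) (simp add: LIM_zero)
    show "AE v in surface_measure. norm \<bar>f n v - g v\<bar> \<le> 2 * C" for n
    proof (intro AE_I2)
      fix v show "norm \<bar>f n v - g v\<bar> \<le> 2 * C" using C[of n v] gC[of v] by simp
    qed
  qed simp_all
  then have "?d \<longlonglongrightarrow> 0" by simp
  then have d0: "(\<lambda>n. 1 / (2 * sqrt \<epsilon>) * ?d n) \<longlonglongrightarrow> 0" by (rule tendsto_mult_right_zero)
  have "norm (round_value \<epsilon> (f n) - round_value \<epsilon> g) \<le> 1 / (2 * sqrt \<epsilon>) * ?d n" for n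
    using round_value_lipschitz[OF f C g gC, of n] round_value_lipschitz[OF g gC f C, of n]
    by (simp add: abs_le_iff abs_minus_commute)
  then have "(\<lambda>n. round_value \<epsilon> (f n) - round_value \<epsilon> g) \<longlonglongrightarrow> 0"
    by (intro Lim_null_comparison[OF _ d0] always_eventually allI)
  then show ?thesis by (rule LIM_zero_cancel)
qed

lemma round_value_mono:
  fixes f g :: "'a \<Rightarrow> real"
  assumes f: "f \<in> borel_measurable borel" "\<And>v. \<bar>f v\<bar> \<le> C"
    and g: "g \<in> borel_measurable borel" "\<And>v. \<bar>g v\<bar> \<le> C"
    and le: "\<And>v. norm v = 1 \<Longrightarrow> f v \<le> g v"
  shows "round_value \<epsilon> f \<le> round_value \<epsilon> g"
proof -
  obtain A B where AB: "saddle_sets \<epsilon> f A B" using exists_saddle_sets f(1) by blast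
  obtain A' B' where AB': "saddle_sets \<epsilon> g A' B'" using exists_saddle_sets g(1) by blast
  have adm: "A \<in> admissible_sets \<epsilon>" "B' \<in> admissible_sets \<epsilon>"
    using AB AB' by (auto simp: saddle_sets_def)
  have "round_value \<epsilon> f = mean_on surface_measure (A \<inter> B) f"
    by (rule round_value_eq_saddle[OF eps f AB])
  also have "\<dots> \<le> mean_on surface_measure (A \<inter> B') f"
    by (rule saddle_sets_best_reply_min[OF eps f AB adm(2)])
  also have "\<dots> \<le> mean_on surface_measure (A \<inter> B') g"
    using adm le by (intro surf.mean_on_mono[where C=C]) (auto simp: f g admissible_sets_def)
  also have "\<dots> \<le> mean_on surface_measure (A' \<inter> B') g"
    by (rule saddle_sets_best_reply_max[OF eps g AB' adm(1)])
  also have "\<dots> = round_value \<epsilon> g"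
    by (rule round_value_eq_saddle[OF eps g AB', symmetric])
  finally show ?thesis .
qed

lemma measurable_step[measurable]: "(\<lambda>v. x + \<epsilon> *\<^sub>R v) \<in> borel_measurable (borel :: 'a measure)"
  by measurable

lemma exists_saddle_selection:
  assumes u[measurable]: "u \<in> borel_measurable (borel :: 'a measure)"
  obtains A B where "Sigma UNIV A \<in> sets (borel \<Otimes>\<^sub>M borel)" "Sigma UNIV B \<in> sets (borel \<Otimes>\<^sub>M borel)"
    "\<And>x. saddle_sets \<epsilon> (\<lambda>v. u (x + \<epsilon> *\<^sub>R v)) (A x) (B x)"
proof -
  have "(\<lambda>(x, v). u (x + \<epsilon> *\<^sub>R v)) \<in> borel_measurable (borel \<Otimes>\<^sub>M borel)" by measurable
  from exists_measurable_saddle_sets[OF dim eps admissible_ne this] show ?thesis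
    using that by (metis UNIV_I space_borel)
qed

text \<open>
  The value is a supremum of infima over uncountable families of sets; it is measurable because it equals
  the mean over the band of a measurable selection of saddle points.
\<close>

lemma measurable_round_value:
  assumes u[measurable]: "u \<in> borel_measurable (borel :: 'a measure)" and C: "\<And>x. \<bar>u x\<bar> \<le> C"
  shows "(\<lambda>x. round_value \<epsilon> (\<lambda>v. u (x + \<epsilon> *\<^sub>R v))) \<in> borel_measurable borel"
proof -
  obtain A B where Sg: "Sigma UNIV A \<in> sets (borel \<Otimes>\<^sub>M borel)" "Sigma UNIV B \<in> sets (borel \<Otimes>\<^sub>M borel)"
    and s: "\<And>x. saddle_sets \<epsilon> (\<lambda>v. u (x + \<epsilon> *\<^sub>R v)) (A x) (B x)"
    using exists_saddle_selection[OF u] by blast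
  have sN: "sets (borel \<Otimes>\<^sub>M surface_measure) = sets (borel \<Otimes>\<^sub>M (borel :: 'a measure))"
    by (intro sets_pair_measure_cong) auto
  have [measurable]: "Sigma UNIV A \<inter> Sigma UNIV B \<in> sets (borel \<Otimes>\<^sub>M surface_measure)"
    using Sg by (simp add: sN)
  have "(\<lambda>(x, v). indicator (Sigma UNIV A \<inter> Sigma UNIV B) (x, v) * u (x + \<epsilon> *\<^sub>R v))
      \<in> borel_measurable (borel \<Otimes>\<^sub>M surface_measure)"
    by measurable
  then have "(\<lambda>x. LINT v|surface_measure. indicator (Sigma UNIV A \<inter> Sigma UNIV B) (x, v) * u (x + \<epsilon> *\<^sub>R v))
      \<in> borel_measurable borel"
    by (rule surf.borel_measurable_lebesgue_integral)
  then have "(\<lambda>x. 1 / (2 * sqrt \<epsilon>) *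
      (LINT v|surface_measure. indicator (Sigma UNIV A \<inter> Sigma UNIV B) (x, v) * u (x + \<epsilon> *\<^sub>R v)))
      \<in> borel_measurable borel" by measurable
  moreover have "round_value \<epsilon> (\<lambda>v. u (x + \<epsilon> *\<^sub>R v)) = 1 / (2 * sqrt \<epsilon>) *
      (LINT v|surface_measure. indicator (Sigma UNIV A \<inter> Sigma UNIV B) (x, v) * u (x + \<epsilon> *\<^sub>R v))" for x
  proof -
    have "round_value \<epsilon> (\<lambda>v. u (x + \<epsilon> *\<^sub>R v)) = mean_on surface_measure (A x \<inter> B x) (\<lambda>v. u (x + \<epsilon> *\<^sub>R v))"
      by (rule round_value_eq_saddle[OF eps _ C s]) measurable
    also have "\<dots> = 1 / (2 * sqrt \<epsilon>) *
      (LINT v|surface_measure. indicator (Sigma UNIV A \<inter> Sigma UNIV B) (x, v) * u (x + \<epsilon> *\<^sub>R v))"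
      using s[of x] unfolding mean_on_def set_lebesgue_integral_def saddle_sets_def
      by (auto intro!: arg_cong[where f="\<lambda>y. _ * y"] Bochner_Integration.integral_cong simp: indicator_def)
    finally show ?thesis .
  qed
  ultimately show ?thesis by simp
qed

section \<open>Existence of a solution\<close>

text \<open>
  Reversing the direction \<open>d\<close> exchanges the two sets and leaves the band unchanged, so the mean of
  \<open>d \<bullet> v\<close> over the band can be made nonnegative.
\<close>

lemma exists_saddle_with_nonneg_mean:
  obtains d :: 'a and A B where "norm d = 1" "saddle_sets \<epsilon> (\<lambda>v. d \<bullet> v) A B"
    "0 \<le> (LINT v:A \<inter> B|surface_measure. d \<bullet> v)"
proof -
  obtain e :: 'a where e: "norm e = 1" using vector_choose_size[of 1] by auto
  obtain A B where s: "saddle_sets \<epsilon> (\<lambda>v. e \<bullet> v) A B"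
    using exists_saddle_sets[of "\<lambda>v. e \<bullet> v"] by auto
  show ?thesis
  proof (cases "0 \<le> (LINT v:A \<inter> B|surface_measure. e \<bullet> v)")
    case True
    show ?thesis by (rule that[OF e s True])
  next
    case False
    have "(LINT v:B \<inter> A|surface_measure. (- e) \<bullet> v) = - (LINT v:A \<inter> B|surface_measure. e \<bullet> v)"
      by (simp add: set_lebesgue_integral_def Int_commute)
    with False show ?thesis
      using e saddle_sets_uminus[OF s] by (intro that[of "-e" B A]) auto
  qed
qed

text \<open>
  The barrier that bounds the duration of the game. On the ball of radius \<open>\<rho>\<close> take
  \<open>w x = C - a * (\<rho> + d \<bullet> x)\<^sup>2\<close>, where the term to be squared is nonnegative. On a sphere of steps from \<open>x\<close>
  this is a decreasing function of \<open>d \<bullet> v\<close>, so its saddle sets are those of \<open>d \<bullet> v\<close>, exchanged.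
  The mean over the band of the square \<open>(r + \<epsilon> * (d \<bullet> v))\<^sup>2\<close>, where \<open>r = \<rho> + d \<bullet> x\<close>, exceeds \<open>r\<^sup>2\<close> by
  at least \<open>\<epsilon>\<^sup>2\<close> times the mean of \<open>(d \<bullet> v)\<^sup>2\<close>: the cross term is nonnegative by the choice of \<open>d\<close>. This
  mean is positive because the hyperplane orthogonal to \<open>d\<close> is null, and \<open>a\<close> is chosen so that the gain
  is \<open>\<epsilon>\<^sup>2 * K\<close>.
\<close>

lemma exists_supersolution:
  assumes \<rho>: "0 \<le> \<rho>"
  obtains w :: "'a \<Rightarrow> real" and C where "w \<in> borel_measurable borel" "\<And>x. 0 \<le> w x" "\<And>x. w x \<le> C"
    "\<And>x. norm x + \<epsilon> \<le> \<rho> \<Longrightarrow> round_value \<epsilon> (\<lambda>v. w (x + \<epsilon> *\<^sub>R v)) + \<epsilon>\<^sup>2 * K \<le> w x"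
proof -
  let ?\<mu> = "surface_measure :: 'a measure"
  obtain d :: 'a and A B where d: "norm d = 1" and s: "saddle_sets \<epsilon> (\<lambda>v. d \<bullet> v) A B"
    and drift: "0 \<le> (LINT v:A \<inter> B|?\<mu>. d \<bullet> v)"
    using exists_saddle_with_nonneg_mean .
  let ?S = "A \<inter> B"
  have adm: "A \<in> admissible_sets \<epsilon>" "B \<in> admissible_sets \<epsilon>"
    and l: "measure ?\<mu> ?S = 2 * sqrt \<epsilon>"
    using s by (auto simp: saddle_sets_def)
  have S: "?S \<in> sets borel" using adm by (auto simp: admissible_sets_borel)
  note [measurable] = S
  have sph: "norm v = 1" if "v \<in> A \<or> v \<in> B" for v using that adm by (auto simp: admissible_sets_def)
  have dv: "\<bar>d \<bullet> v\<bar> \<le> norm v" for v using Cauchy_Schwarz_ineq2[of d v] d by simp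
  have int1: "integrable ?\<mu> (\<lambda>v. indicator ?S v * (d \<bullet> v))"
  proof (rule surf.integrable_bounded[where C=1])
    show "\<bar>indicator ?S v * (d \<bullet> v)\<bar> \<le> 1" for v using dv[of v] sph[of v] by (auto simp: indicator_def)
  qed measurable
  have int2: "integrable ?\<mu> (\<lambda>v. indicator ?S v * (d \<bullet> v)\<^sup>2)"
  proof (rule surf.integrable_bounded[where C=1])
    show "\<bar>indicator ?S v * (d \<bullet> v)\<^sup>2\<bar> \<le> 1" for v
      using dv[of v] sph[of v] by (auto simp: indicator_def abs_square_le_1)
  qed measurable
  have int0: "integrable ?\<mu> (\<lambda>v. indicator ?S v :: real)"
  proof (rule surf.integrable_bounded[where C=1])
    show "(indicator ?S :: 'a \<Rightarrow> real) \<in> borel_measurable ?\<mu>" by simp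
  qed (simp add: indicator_def)
  define q where "q = (LINT v|?\<mu>. indicator ?S v * (d \<bullet> v)\<^sup>2)"
  have q: "q > 0"
  proof (rule ccontr)
    assume "\<not> q > 0"
    moreover have "q \<ge> 0" unfolding q_def by (intro integral_nonneg_AE AE_I2) (auto simp: indicator_def)
    ultimately have "q = 0" by simp
    then have "AE v in ?\<mu>. indicator ?S v * (d \<bullet> v)\<^sup>2 = 0"
      unfolding q_def using integral_nonneg_eq_0_iff_AE[OF int2] by (auto simp: indicator_def)
    moreover have "AE v in ?\<mu>. v \<notin> {v. d \<bullet> v = 0}"
      using emeasure_surface_measure_slice[OF dim d, of 0]
      by (intro AE_not_in) (auto simp: null_sets_def intro!: borel_closed closed_Collect_eq continuous_intros)
    ultimately have "AE v in ?\<mu>. v \<notin> ?S" by eventually_elim (auto simp: indicator_def)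
    then have "measure ?\<mu> ?S = measure ?\<mu> {}" using S by (intro measure_eq_AE) auto
    with l eps show False by simp
  qed
  define a where "a = K * (2 * sqrt \<epsilon>) / q"
  have a: "0 < a" using K eps q by (simp add: a_def)
  define C where "C = 4 * a * \<rho>\<^sup>2"
  define w where "w x = (if norm x \<le> \<rho> then C - a * (\<rho> + d \<bullet> x)\<^sup>2 else 0)" for x
  have le2: "0 \<le> \<rho> + d \<bullet> x" "\<rho> + d \<bullet> x \<le> 2 * \<rho>" if "norm x \<le> \<rho>" for x
    using dv[of x] that by auto
  have w0: "0 \<le> w x" for x
  proof (cases "norm x \<le> \<rho>")
    case True
    have "(\<rho> + d \<bullet> x)\<^sup>2 \<le> (2 * \<rho>)\<^sup>2" using le2[OF True] by (intro power_mono)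
    then have "a * (\<rho> + d \<bullet> x)\<^sup>2 \<le> a * (2 * \<rho>)\<^sup>2" using a by (intro mult_left_mono) auto
    then show ?thesis using True by (simp add: w_def C_def power_mult_distrib)
  qed (simp add: w_def)
  have wC: "w x \<le> C" for x using a by (auto simp: w_def C_def)
  have wm[measurable]: "w \<in> borel_measurable borel" unfolding w_def by measurable
  have super: "round_value \<epsilon> (\<lambda>v. w (x + \<epsilon> *\<^sub>R v)) + \<epsilon>\<^sup>2 * K \<le> w x" if x: "norm x + \<epsilon> \<le> \<rho>" for x
  proof -
    define r where "r = \<rho> + d \<bullet> x"
    have r: "0 \<le> r" "norm x \<le> \<rho>" using le2[of x] x eps by (auto simp: r_def)
    have near: "norm (x + \<epsilon> *\<^sub>R v) \<le> \<rho>" if "norm v = 1" for v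
      using x eps norm_triangle_ineq[of x "\<epsilon> *\<^sub>R v"] that by simp
    have wv: "w (x + \<epsilon> *\<^sub>R v) = C - a * (r + \<epsilon> * (d \<bullet> v))\<^sup>2" "0 \<le> r + \<epsilon> * (d \<bullet> v)" if "norm v = 1" for v
      using near[OF that] le2[OF near[OF that]] by (auto simp: w_def r_def inner_add_right algebra_simps)
    have anti: "w (x + \<epsilon> *\<^sub>R v') \<le> w (x + \<epsilon> *\<^sub>R v)"
      if "norm v = 1" "norm v' = 1" "d \<bullet> v \<le> d \<bullet> v'" for v v'
    proof -
      have "(r + \<epsilon> * (d \<bullet> v))\<^sup>2 \<le> (r + \<epsilon> * (d \<bullet> v'))\<^sup>2"
        using that wv(2)[of v] eps by (intro power_mono) auto
      then show ?thesis using a that by (simp add: wv)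
    qed
    have s': "saddle_sets \<epsilon> (\<lambda>v. w (x + \<epsilon> *\<^sub>R v)) B A"
      using s anti sph by (auto simp: saddle_sets_def Int_commute)
    have "round_value \<epsilon> (\<lambda>v. w (x + \<epsilon> *\<^sub>R v)) = mean_on ?\<mu> (B \<inter> A) (\<lambda>v. w (x + \<epsilon> *\<^sub>R v))"
      by (rule round_value_eq_saddle[OF eps _ _ s', of C]) (use w0 wC in \<open>auto intro!: measurable_compose[OF measurable_step]\<close>)
    also have "\<dots> = 1 / (2 * sqrt \<epsilon>) * (LINT v|?\<mu>. indicator ?S v * (C - a * (r + \<epsilon> * (d \<bullet> v))\<^sup>2))"
    proof -
      have "indicator ?S v *\<^sub>R w (x + \<epsilon> *\<^sub>R v) = indicator ?S v * (C - a * (r + \<epsilon> * (d \<bullet> v))\<^sup>2)" for v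
        using wv(1)[OF sph, of v] by (cases "v \<in> A \<inter> B") auto
      then show ?thesis unfolding mean_on_def set_lebesgue_integral_def using l
        by (simp only: Int_commute[of B A])
    qed
    also have "(LINT v|?\<mu>. indicator ?S v * (C - a * (r + \<epsilon> * (d \<bullet> v))\<^sup>2)) =
        (LINT v|?\<mu>. (C - a * r\<^sup>2) * indicator ?S v - 2 * a * r * \<epsilon> * (indicator ?S v * (d \<bullet> v))
          - a * \<epsilon>\<^sup>2 * (indicator ?S v * (d \<bullet> v)\<^sup>2))"
      by (intro Bochner_Integration.integral_cong) (auto simp: algebra_simps power2_eq_square)
    also have "\<dots> = (C - a * r\<^sup>2) * (2 * sqrt \<epsilon>) - 2 * a * r * \<epsilon> * (LINT v|?\<mu>. indicator ?S v * (d \<bullet> v)) - a * \<epsilon>\<^sup>2 * q"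
      using int0 int1 int2 S by (simp add: q_def l)
    also have "\<dots> \<le> (C - a * r\<^sup>2) * (2 * sqrt \<epsilon>) - a * \<epsilon>\<^sup>2 * q"
      using drift a r eps by (simp add: set_lebesgue_integral_def)
    finally have "round_value \<epsilon> (\<lambda>v. w (x + \<epsilon> *\<^sub>R v)) \<le> 1 / (2 * sqrt \<epsilon>) * ((C - a * r\<^sup>2) * (2 * sqrt \<epsilon>) - a * \<epsilon>\<^sup>2 * q)"
      using eps by (simp add: mult_left_mono divide_right_mono)
    also have "\<dots> = C - a * r\<^sup>2 - \<epsilon>\<^sup>2 * K"
      using eps q by (simp add: a_def field_simps)
    finally show ?thesis using r by (simp add: w_def r_def)
  qed
  show ?thesis by (rule that[OF wm w0 wC super])
qed

primrec value_iteration :: "nat \<Rightarrow> 'a \<Rightarrow> real" where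
  "value_iteration 0 x = 0"
| "value_iteration (Suc n) x =
     (if x \<in> \<Omega> then round_value \<epsilon> (\<lambda>v. value_iteration n (x + \<epsilon> *\<^sub>R v)) + \<epsilon>\<^sup>2 * K else 0)"

lemma dpp_solution_iff:
  "dpp_solution \<Omega> K \<epsilon> u \<longleftrightarrow> u \<in> borel_measurable borel \<and> bounded (range u) \<and>
     (\<forall>x\<in>\<Omega>. u x = round_value \<epsilon> (\<lambda>v. u (x + \<epsilon> *\<^sub>R v)) + \<epsilon>\<^sup>2 * K) \<and> (\<forall>x. x \<notin> \<Omega> \<longrightarrow> u x = 0)"
  by (simp add: dpp_solution_def round_value_def mean_on_def)

text \<open>
  Value iteration from zero is increasing, because the value of a round is monotone, and stays below the
  barrier. Its pointwise limit is a solution by the continuity of the value of a round under bounded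
  pointwise convergence.
\<close>

lemma exists_dpp_solution: "\<exists>u. dpp_solution \<Omega> K \<epsilon> u"
proof -
  let ?U = value_iteration
  obtain r where r: "\<And>x. x \<in> \<Omega> \<Longrightarrow> norm x \<le> r" using bounded_\<Omega> by (auto simp: bounded_iff)
  \<comment> \<open>The barrier must hold on a ball that contains every position reachable in one step from the domain.\<close>
  define \<rho> where "\<rho> = \<bar>r\<bar> + \<epsilon>"
  have \<rho>: "0 \<le> \<rho>" "\<And>x. x \<in> \<Omega> \<Longrightarrow> norm x + \<epsilon> \<le> \<rho>" using r eps by (force simp: \<rho>_def)+
  obtain w :: "'a \<Rightarrow> real" and C where w: "w \<in> borel_measurable borel" "\<And>x. 0 \<le> w x" "\<And>x. w x \<le> C"
    and super: "\<And>x. norm x + \<epsilon> \<le> \<rho> \<Longrightarrow> round_value \<epsilon> (\<lambda>v. w (x + \<epsilon> *\<^sub>R v)) + \<epsilon>\<^sup>2 * K \<le> w x"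
    using exists_supersolution[OF \<rho>(1)] by blast
  have wC: "\<bar>w x\<bar> \<le> C" for x using w(2,3)[of x] by simp
  have comp: "(\<lambda>v. u (x + \<epsilon> *\<^sub>R v)) \<in> borel_measurable borel" if "u \<in> borel_measurable borel" for u :: "'a \<Rightarrow> real" and x
    using measurable_compose[OF measurable_step that] .
  have inv: "?U n \<in> borel_measurable borel \<and> (\<forall>x. 0 \<le> ?U n x \<and> ?U n x \<le> w x)" for n
  proof (induction n)
    case 0
    have "?U 0 = (\<lambda>_. 0)" by (simp add: fun_eq_iff)
    then show ?case by (simp add: w)
  next
    case (Suc n)
    have UC: "\<bar>?U n x\<bar> \<le> C" for x using Suc w(3)[of x] by (metis abs_of_nonneg order_trans)
    have [measurable]: "(\<lambda>x. round_value \<epsilon> (\<lambda>v. ?U n (x + \<epsilon> *\<^sub>R v))) \<in> borel_measurable borel"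
      by (rule measurable_round_value[OF _ UC]) (use Suc in blast)
    have "?U (Suc n) = (\<lambda>x. if x \<in> \<Omega> then round_value \<epsilon> (\<lambda>v. ?U n (x + \<epsilon> *\<^sub>R v)) + \<epsilon>\<^sup>2 * K else 0)"
      by (simp add: fun_eq_iff)
    also have "\<dots> \<in> borel_measurable borel" by measurable
    finally have "?U (Suc n) \<in> borel_measurable borel" .
    moreover have "0 \<le> ?U (Suc n) x \<and> ?U (Suc n) x \<le> w x" for x
    proof (cases "x \<in> \<Omega>")
      case True
      have "round_value \<epsilon> (\<lambda>v::'a. 0) \<le> round_value \<epsilon> (\<lambda>v. ?U n (x + \<epsilon> *\<^sub>R v))"
      proof (rule round_value_mono[OF _ _ comp UC])
        show "\<bar>0 :: real\<bar> \<le> C" using wC[of x] by simp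
      qed (use Suc in auto)
      moreover have "round_value \<epsilon> (\<lambda>v. ?U n (x + \<epsilon> *\<^sub>R v)) \<le> round_value \<epsilon> (\<lambda>v. w (x + \<epsilon> *\<^sub>R v))"
        by (rule round_value_mono[OF comp UC comp wC]) (use Suc w(1) in auto)
      moreover have "round_value \<epsilon> (\<lambda>v::'a. 0) = 0"
        using admissible_ne by (simp add: round_value_def mean_on_def set_lebesgue_integral_def)
      moreover have "0 \<le> \<epsilon>\<^sup>2 * K" using K by simp
      ultimately show ?thesis using super[OF \<rho>(2)[OF True]] True by simp
    qed (use w in simp)
    ultimately show ?case by blast
  qed
  then have Um: "\<And>n. ?U n \<in> borel_measurable borel" and U0: "\<And>n x. 0 \<le> ?U n x"
    by auto
  have UC: "\<bar>?U n x\<bar> \<le> C" for n x using inv[of n] w(3)[of x] by (metis abs_of_nonneg order_trans)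
  have mono: "?U n x \<le> ?U (Suc n) x" for n x
  proof (induction n arbitrary: x)
    case 0
    then show ?case using U0[of "Suc 0"] by simp
  next
    case (Suc n)
    then show ?case
      using UC Um
      by (auto intro!: round_value_mono[where C=C] comp simp del: value_iteration.simps(2)
          simp: value_iteration.simps(2)[of "Suc n"] value_iteration.simps(2)[of n x])
  qed
  define u where "u x = lim (\<lambda>n. ?U n x)" for x
  have lim: "(\<lambda>n. ?U n x) \<longlonglongrightarrow> u x" for x
  proof -
    have "incseq (\<lambda>n. ?U n x)" using mono by (rule incseq_SucI)
    moreover have "?U n x \<le> C" for n using UC[of n x] by simp
    ultimately have "convergent (\<lambda>n. ?U n x)"
      by (metis convergent_def incseq_convergent)
    then show ?thesis unfolding u_def by (simp add: convergent_LIMSEQ_iff)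
  qed
  have "u \<in> borel_measurable borel" using lim Um by (rule borel_measurable_LIMSEQ_real)
  moreover have "\<bar>u x\<bar> \<le> C" for x
    using LIMSEQ_le_const2[OF tendsto_rabs[OF lim]] UC by blast
  then have "bounded (range u)" by (auto simp: bounded_iff)
  moreover have "u x = round_value \<epsilon> (\<lambda>v. u (x + \<epsilon> *\<^sub>R v)) + \<epsilon>\<^sup>2 * K" if "x \<in> \<Omega>" for x
  proof (rule LIMSEQ_unique)
    show "(\<lambda>n. ?U (Suc n) x) \<longlonglongrightarrow> u x" using lim by (rule LIMSEQ_Suc)
    have "(\<lambda>n. round_value \<epsilon> (\<lambda>v. ?U n (x + \<epsilon> *\<^sub>R v)) + \<epsilon>\<^sup>2 * K) \<longlonglongrightarrow>
        round_value \<epsilon> (\<lambda>v. u (x + \<epsilon> *\<^sub>R v)) + \<epsilon>\<^sup>2 * K"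
      by (intro tendsto_add tendsto_const round_value_tendsto[where C=C] comp Um UC lim)
    then show "(\<lambda>n. ?U (Suc n) x) \<longlonglongrightarrow> round_value \<epsilon> (\<lambda>v. u (x + \<epsilon> *\<^sub>R v)) + \<epsilon>\<^sup>2 * K"
      using that by simp
  qed
  moreover have "u x = 0" if "x \<notin> \<Omega>" for x
  proof -
    have "?U n x = 0" for n using that by (cases n) auto
    then have "(\<lambda>n. ?U n x) \<longlonglongrightarrow> 0" by simp
    with lim[of x] show ?thesis by (rule LIMSEQ_unique)
  qed
  ultimately show ?thesis unfolding dpp_solution_iff by blast
qed

end

section \<open>The number of plays and sums of survival probabilities\<close>

lemma number_of_plays_eq_suminf:
  "number_of_plays \<Omega> \<omega> = (\<Sum>n. indicator {\<omega>. \<forall>k\<le>n. \<omega> k \<in> \<Omega>} \<omega>)"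
proof (cases "\<exists>n. \<omega> n \<notin> \<Omega>")
  case True
  define L where "L = (LEAST n. \<omega> n \<notin> \<Omega>)"
  have L: "\<omega> L \<notin> \<Omega>" unfolding L_def using True by (rule LeastI_ex)
  have before: "\<omega> k \<in> \<Omega>" if "k < L" for k using not_less_Least that unfolding L_def by blast
  have ind: "indicator {\<omega>. \<forall>k\<le>n. \<omega> k \<in> \<Omega>} \<omega> = (if n < L then 1 else 0 :: ennreal)" for n
    using before L by (auto simp: indicator_def not_less intro: le_less_trans)
  have "(\<Sum>n. indicator {\<omega>. \<forall>k\<le>n. \<omega> k \<in> \<Omega>} \<omega>) = (\<Sum>n<L. 1 :: ennreal)"
    unfolding ind by (subst suminf_finite[of "{..<L}"]) auto
  then show ?thesis using True by (simp add: number_of_plays_def L_def[symmetric])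
next
  case False
  then have ind: "indicator {\<omega>. \<forall>k\<le>n. \<omega> k \<in> \<Omega>} \<omega> = ennreal 1" for n by simp
  have "\<not> summable (\<lambda>n::nat. 1 :: real)" by (simp add: summable_const_iff)
  then have "(\<Sum>n::nat. ennreal 1) = top"
    using summable_suminf_not_top[of "\<lambda>_. 1"] by auto
  then show ?thesis using False unfolding ind by (simp add: number_of_plays_def)
qed

text \<open>
  In the application \<open>p n\<close> is the probability that the game is still running after \<open>n\<close> rounds and \<open>y n\<close>
  the expected value of the remaining game. The decrease of the bounded sequence \<open>y\<close> forces the \<open>p n\<close> to be summable; then \<open>y\<close> tends to
  zero and telescoping gives the sharp bound.
\<close>

lemma suminf_le_of_decrease:
  fixes y p :: "nat \<Rightarrow> real"
  assumes p: "\<And>n. 0 \<le> p n" "\<And>n. p n \<le> 1" and y: "\<And>n. \<bar>y n\<bar> \<le> C * p n" and c: "0 < c"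
    and step: "\<And>n. y (Suc n) \<le> y n - c * p n"
  shows "0 \<le> y 0" "(\<Sum>n. ennreal (c * p n)) \<le> ennreal (y 0)"
proof -
  have C: "C * p n \<le> \<bar>C\<bar>" for n
    using p mult_left_le[of "p n" "\<bar>C\<bar>"] mult_right_mono[of C "\<bar>C\<bar>" "p n"] by fastforce
  have part: "(\<Sum>k<n. c * p k) \<le> y 0 - y n" for n
  proof (induction n)
    case (Suc n)
    then show ?case using step[of n] by simp
  qed simp
  have "(\<Sum>k<n. c * p k) \<le> y 0 + \<bar>C\<bar>" for n
    using part[of n] y[of n] C[of n] by linarith
  then have s: "summable (\<lambda>n. c * p n)"
    using p c by (intro summableI_nonneg_bounded[where x="y 0 + \<bar>C\<bar>"]) auto
  have "(\<lambda>n. C / c * (c * p n)) \<longlonglongrightarrow> 0" by (intro tendsto_mult_right_zero summable_LIMSEQ_zero s)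
  then have "(\<lambda>n. C * p n) \<longlonglongrightarrow> 0" using c by simp
  then have "y \<longlonglongrightarrow> 0" using y by (intro Lim_null_comparison[of y]) auto
  from tendsto_diff[OF tendsto_const[of "y 0"] this] have lim: "(\<lambda>n. y 0 - y n) \<longlonglongrightarrow> y 0" by simp
  have le: "(\<Sum>n. c * p n) \<le> y 0"
    by (rule LIMSEQ_le[OF summable_LIMSEQ[OF s] lim]) (use part in blast)
  have "0 \<le> (\<Sum>n. c * p n)" using p c by (intro suminf_nonneg s) auto
  with le show "0 \<le> y 0" by simp
  show "(\<Sum>n. ennreal (c * p n)) \<le> ennreal (y 0)"
    using p c s le by (subst suminf_ennreal2) (auto intro: ennreal_leI)
qed

text \<open>
  If the \<open>p n\<close> are not summable, the sum on the right is infinite; so no control of the duration of the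
  game is needed for a lower bound.
\<close>

lemma suminf_ge_of_slow_decrease:
  fixes y p :: "nat \<Rightarrow> real"
  assumes p: "\<And>n. 0 \<le> p n" and y: "\<And>n. \<bar>y n\<bar> \<le> C * p n" and c: "0 < c"
    and step: "\<And>n. y n - c * p n \<le> y (Suc n)"
  shows "ennreal (y 0) \<le> (\<Sum>n. ennreal (c * p n))"
proof (cases "summable (\<lambda>n. c * p n)")
  case True
  have part: "y 0 - y n \<le> (\<Sum>k<n. c * p k)" for n
  proof (induction n)
    case (Suc n)
    then show ?case using step[of n] by simp
  qed simp
  have "(\<lambda>n. C / c * (c * p n)) \<longlonglongrightarrow> 0" by (intro tendsto_mult_right_zero summable_LIMSEQ_zero True)
  then have "(\<lambda>n. C * p n) \<longlonglongrightarrow> 0" using c by simp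
  then have "y \<longlonglongrightarrow> 0" using y by (intro Lim_null_comparison[of y]) auto
  from tendsto_diff[OF tendsto_const[of "y 0"] this] have lim: "(\<lambda>n. y 0 - y n) \<longlonglongrightarrow> y 0" by simp
  have "y 0 \<le> (\<Sum>n. c * p n)"
    by (rule LIMSEQ_le[OF lim summable_LIMSEQ[OF True]]) (use part in blast)
  then show ?thesis
    using p c True by (subst suminf_ennreal2) (auto intro: ennreal_leI)
next
  case False
  then have "(\<Sum>n. ennreal (c * p n)) = top"
    using summable_suminf_not_top[of "\<lambda>n. c * p n"] mult_nonneg_nonneg[OF less_imp_le[OF c] p] by blast
  then show ?thesis by (simp only: top_greatest)
qed

lemma integral_uniform_surface_measure:
  fixes f :: "'a::euclidean_space \<Rightarrow> real"
  assumes S: "S \<in> sets borel" and pos: "0 < measure surface_measure S" and f: "f \<in> borel_measurable borel"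
  shows "(LINT v|uniform_measure surface_measure S. f v) = mean_on surface_measure S f"
proof -
  have "indicator S v / emeasure surface_measure S = ennreal (indicator S v / measure surface_measure S)" for v
    using pos by (auto simp: surf.emeasure_eq_measure indicator_def divide_ennreal ennreal_1[symmetric] simp del: ennreal_1)
  then have "(LINT v|uniform_measure surface_measure S. f v) =
      (LINT v|density surface_measure (\<lambda>v. indicator S v / measure surface_measure S). f v)"
    by (simp add: uniform_measure_def)
  also have "\<dots> = (LINT v|surface_measure. (indicator S v / measure surface_measure S) *\<^sub>R f v)"
    using S f by (intro integral_density) auto
  also have "\<dots> = mean_on surface_measure S f"
    by (simp add: mean_on_def set_lebesgue_integral_def)
  finally show ?thesis .
qed

section \<open>The course of a play\<close>

locale random_direction_play = random_direction_game \<Omega> K \<epsilon>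
  for \<Omega> :: "'a::euclidean_space set" and K \<epsilon> :: real +
  fixes x0 :: 'a and Sp Sc :: "nat \<Rightarrow> (nat \<Rightarrow> 'a) \<Rightarrow> 'a set"
  assumes Sp: "Sp \<in> strategies \<epsilon>" and Sc: "Sc \<in> strategies \<epsilon>"
begin

sublocale IT: Ionescu_Tulcea "game_kernel \<epsilon> x0 Sp Sc" "\<lambda>_. borel"
  by (rule Ionescu_Tulcea_game_kernel[OF eps Sp Sc])

text \<open>
  The law of the positions \<open>0, \<dots>, n\<close>.
\<close>

definition hist :: "nat \<Rightarrow> (nat \<Rightarrow> 'a) measure" where
  "hist n = IT.C 0 (Suc n) (\<lambda>_. undefined)"

definition alive :: "nat \<Rightarrow> (nat \<Rightarrow> 'a) set" where
  "alive n = {h. \<forall>k\<le>n. h k \<in> \<Omega>}"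

lemma sets_hist [measurable_cong]: "sets (hist n) = sets (PiM {0..<Suc n} (\<lambda>_. borel))"
  unfolding hist_def by (subst IT.sets_C) simp_all

lemma measurable_hist: "measurable (hist n) N = measurable (PiM {0..<Suc n} (\<lambda>_. borel)) N"
  by (rule measurable_cong_sets[OF sets_hist refl])

lemma space_hist: "space (hist n) = space (PiM {0..<Suc n} (\<lambda>_. borel))"
  by (rule sets_eq_imp_space_eq[OF sets_hist])

lemma prob_space_hist: "prob_space (hist n)"
  unfolding hist_def by (rule IT.prob_space_C) simp

lemma alive_pred [measurable]: "Measurable.pred (PiM {0..<Suc n} (\<lambda>_. borel)) (\<lambda>h. h \<in> alive n)"
proof -
  have [measurable]: "(\<lambda>h. h k) \<in> PiM {0..<Suc n} (\<lambda>_. borel) \<rightarrow>\<^sub>M borel" if "k \<in> {..n}" for k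
    using that by (intro measurable_component_singleton) auto
  have "h \<in> alive n \<longleftrightarrow> (\<forall>k\<in>{..n}. h k \<in> \<Omega>)" for h by (auto simp: alive_def)
  moreover have "Measurable.pred (PiM {0..<Suc n} (\<lambda>_. borel)) (\<lambda>h. \<forall>k\<in>{..n}. h k \<in> \<Omega>)"
    by measurable
  ultimately show ?thesis by simp
qed

definition survival :: "nat \<Rightarrow> real" where
  "survival n = measure (hist n) {h \<in> space (hist n). h \<in> alive n}"

text \<open>
  The number of plays is the number of rounds \<open>n\<close> for which the positions \<open>0, \<dots>, n\<close> all lie in the domain,
  and each of these events depends on finitely many positions only.
\<close>

lemma expected_payoff_eq_suminf:
  "expected_payoff \<Omega> K \<epsilon> x0 Sp Sc = (\<Sum>n. ennreal (\<epsilon>\<^sup>2 * K * survival n))"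
proof -
  interpret prob_space "hist n" for n by (rule prob_space_hist)
  have em: "emeasure IT.PF.lim {\<omega> \<in> space IT.PF.lim. \<omega> \<in> alive n} = ennreal (survival n)"
    and ms: "{\<omega> \<in> space IT.PF.lim. \<omega> \<in> alive n} \<in> sets IT.PF.lim" for n
  proof -
    let ?J = "{0..<Suc n}"
    let ?X = "{h \<in> space (PiM ?J (\<lambda>_. borel)). h \<in> alive n}"
    have X: "?X \<in> sets (PiM ?J (\<lambda>_. borel))" by measurable
    have emb: "IT.PF.emb UNIV ?J ?X = {\<omega> \<in> space IT.PF.lim. \<omega> \<in> alive n}"
      by (auto simp: prod_emb_def space_PiM alive_def IT.PF.space_lim)
    have "emeasure IT.PF.lim (IT.PF.emb UNIV ?J ?X) = emeasure (IT.CI ?J) ?X"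
      using X by (intro IT.lim) auto
    also have "\<dots> = emeasure (hist n) (IT.PF.emb ?J ?J ?X)"
      unfolding hist_def using X by (intro IT.emeasure_CI) auto
    also have "IT.PF.emb ?J ?J ?X = ?X" using sets.sets_into_space[OF X] by (intro prod_emb_id) (simp add: space_PiM)
    finally show "emeasure IT.PF.lim {\<omega> \<in> space IT.PF.lim. \<omega> \<in> alive n} = ennreal (survival n)"
      by (simp add: emb survival_def emeasure_eq_measure space_hist)
    have "IT.PF.emb UNIV ?J ?X \<in> sets (PiM UNIV (\<lambda>_. borel))" using X by (intro measurable_prod_emb) auto
    then show "{\<omega> \<in> space IT.PF.lim. \<omega> \<in> alive n} \<in> sets IT.PF.lim" by (simp add: emb)
  qed
  define E where "E n = {\<omega> \<in> space IT.PF.lim. \<omega> \<in> alive n}" for n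
  have E: "E n \<in> sets IT.PF.lim" "emeasure IT.PF.lim (E n) = ennreal (survival n)" for n
    using em[of n] ms[of n] by (simp_all only: E_def)
  have m: "(\<lambda>\<omega>. indicator (E n) \<omega> :: ennreal) \<in> borel_measurable IT.PF.lim" for n
    using E(1) by (rule borel_measurable_indicator)
  have "expected_payoff \<Omega> K \<epsilon> x0 Sp Sc = (\<integral>\<^sup>+\<omega>. ennreal (\<epsilon>\<^sup>2 * K) * (\<Sum>n. indicator (E n) \<omega>) \<partial>IT.PF.lim)"
    unfolding expected_payoff_def game_measure_def number_of_plays_eq_suminf
    by (intro nn_integral_cong) (simp add: E_def alive_def indicator_def)
  also have "\<dots> = ennreal (\<epsilon>\<^sup>2 * K) * (\<integral>\<^sup>+\<omega>. (\<Sum>n. indicator (E n) \<omega>) \<partial>IT.PF.lim)"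
    by (intro nn_integral_cmult borel_measurable_suminf_order m)
  also have "(\<integral>\<^sup>+\<omega>. (\<Sum>n. indicator (E n) \<omega>) \<partial>IT.PF.lim) = (\<Sum>n. ennreal (survival n))"
    by (subst nn_integral_suminf) (simp_all only: m nn_integral_indicator[OF E(1)] E(2))
  also have "ennreal (\<epsilon>\<^sup>2 * K) * (\<Sum>n. ennreal (survival n)) = (\<Sum>n. ennreal (\<epsilon>\<^sup>2 * K * survival n))"
  proof -
    have "ennreal (\<epsilon>\<^sup>2 * K * survival n) = ennreal (\<epsilon>\<^sup>2 * K) * ennreal (survival n)" for n
      using K by (intro ennreal_mult) (auto simp: survival_def)
    then show ?thesis by (simp only: ennreal_suminf_cmult)
  qed
  finally show ?thesis .
qed

text \<open>
  The tower property: integrate out the last position first.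
\<close>

lemma integral_C_Suc:
  fixes f :: "(nat \<Rightarrow> 'a) \<Rightarrow> real"
  assumes f: "f \<in> borel_measurable (PiM {0..<Suc n} (\<lambda>_. borel))" and B: "\<And>h. \<bar>f h\<bar> \<le> B"
  shows "(LINT h|IT.C 0 (Suc n) (\<lambda>_. undefined). f h) =
    (LINT h|IT.C 0 n (\<lambda>_. undefined). LINT x|game_kernel \<epsilon> x0 Sp Sc n h. f (h(n := x)))"
proof -
  let ?M = "IT.C 0 n (\<lambda>_. undefined)"
  have u: "(\<lambda>_. undefined) \<in> space (PiM {0..<0::nat} (\<lambda>_. borel :: 'a measure))" by (simp add: space_PiM)
  have sp: "space ?M = space (PiM {0..<n} (\<lambda>_. borel))" using IT.space_C[OF u, of n] by simp
  have se: "sets ?M = sets (PiM {0..<n} (\<lambda>_. borel))" using IT.sets_C[OF u, of n] by simp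
  have "integral\<^sup>L (?M \<bind> IT.eP n) f = (LINT h|?M. LINT h'|IT.eP n h. f h')"
  proof (rule integral_bind[OF f B])
    show "IT.eP n \<in> ?M \<rightarrow>\<^sub>M subprob_algebra (PiM {0..<Suc n} (\<lambda>_. borel))"
      using IT.measurable_eP[of n] by (simp cong: measurable_cong_sets add: measurable_cong_sets[OF se refl])
    show "finite_measure ?M" using IT.prob_space_C[OF u, of n] by (rule prob_space.finite_measure)
    show "AE h in ?M. emeasure (IT.eP n h) (space (IT.eP n h)) \<le> ennreal 1"
      using IT.prob_space_eP[of _ n] by (intro AE_I2) (simp add: sp prob_space.emeasure_space_1)
  qed
  also have "\<dots> = (LINT h|?M. LINT x|game_kernel \<epsilon> x0 Sp Sc n h. f (h(n := x)))"
  proof (rule Bochner_Integration.integral_cong[OF refl])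
    fix h assume "h \<in> space ?M"
    then have h: "h \<in> space (PiM {0..<n} (\<lambda>_. borel))" by (simp add: sp)
    have "fun_upd h n \<in> game_kernel \<epsilon> x0 Sp Sc n h \<rightarrow>\<^sub>M PiM {0..<Suc n} (\<lambda>_. borel)"
      using h by (intro measurable_fun_upd[where J="{0..<n}"])
        (auto simp: measurable_cong_sets[OF IT.sets_P[OF h] refl])
    then show "(LINT h'|IT.eP n h. f h') = (LINT x|game_kernel \<epsilon> x0 Sp Sc n h. f (h(n := x)))"
      unfolding IT.eP_def using f by (rule integral_distr)
  qed
  finally show ?thesis by simp
qed

text \<open>
  When \<open>w\<close> is the value of the game, this is the expected value still to be collected after \<open>n\<close> rounds.
\<close>

definition remaining :: "('a \<Rightarrow> real) \<Rightarrow> nat \<Rightarrow> real" where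
  "remaining w n = (LINT h|hist n. indicator (alive n) h * w (h n))"

lemma borel_measurable_stopped:
  assumes [measurable]: "w \<in> borel_measurable borel"
  shows "(\<lambda>h. indicator (alive n) h * w (h n) :: real) \<in> borel_measurable (PiM {0..<Suc n} (\<lambda>_. borel))"
proof -
  have [measurable]: "(\<lambda>h. h n) \<in> PiM {0..<Suc n} (\<lambda>_. borel) \<rightarrow>\<^sub>M borel"
    by (intro measurable_component_singleton) auto
  have "(\<lambda>h. indicator (alive n) h * w (h n)) = (\<lambda>h. if h \<in> alive n then w (h n) else 0)"
    by (auto simp: indicator_def)
  also have "\<dots> \<in> borel_measurable (PiM {0..<Suc n} (\<lambda>_. borel))" by measurable
  finally show ?thesis .
qed

lemma abs_stopped_le:
  assumes "\<And>x. \<bar>w x :: real\<bar> \<le> C"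
  shows "\<bar>indicator (alive n) h * w (h n)\<bar> \<le> C"
  using assms[of "h n"] by (auto simp: indicator_def)

lemma remaining_0:
  assumes w: "w \<in> borel_measurable borel" "\<And>x. \<bar>w x\<bar> \<le> C" and w0: "\<And>x. x \<notin> \<Omega> \<Longrightarrow> w x = 0"
  shows "remaining w 0 = w x0"
proof -
  let ?f = "\<lambda>h. indicator (alive 0) h * w (h 0)"
  have 0: "?f h = w (h 0)" for h using w0 by (auto simp: alive_def indicator_def)
  have m: "w \<in> borel_measurable (return borel x0)" using w(1) by simp
  have "remaining w 0 = (LINT h|return (PiM {0..<0::nat} (\<lambda>_. borel)) (\<lambda>_. undefined).
      LINT x|game_kernel \<epsilon> x0 Sp Sc 0 h. ?f (h(0 := x)))"
    unfolding remaining_def hist_def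
    by (subst integral_C_Suc[OF borel_measurable_stopped[OF w(1)] abs_stopped_le[of w, OF w(2)]]) simp
  also have "\<dots> = (LINT h|return (PiM {0..<0::nat} (\<lambda>_. borel)) (\<lambda>_. undefined :: 'a). w x0)"
    unfolding 0 by (simp add: game_kernel_def integral_return w)
  also have "\<dots> = w x0" by (subst integral_return) auto
  finally show ?thesis .
qed

lemma survival_bounds: "0 \<le> survival n" "survival n \<le> 1"
  using prob_space.prob_le_1[OF prob_space_hist] by (auto simp: survival_def)

lemma integral_alive: "(LINT h|hist n. indicator (alive n) h) = survival n"
proof -
  have "(LINT h|hist n. indicator (alive n) h) = (LINT h|hist n. indicator {h \<in> space (hist n). h \<in> alive n} h)"
    by (intro Bochner_Integration.integral_cong) (auto simp: indicator_def)
  also have "\<dots> = survival n" by (simp add: survival_def Int_absorb2)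
  finally show ?thesis .
qed

lemma integrable_stopped:
  assumes "f \<in> borel_measurable (hist n)" "\<And>h. \<bar>f h\<bar> \<le> (C :: real)"
  shows "integrable (hist n) f"
  using finite_measure.integrable_bounded[OF prob_space.finite_measure[OF prob_space_hist] assms] .

lemma abs_remaining_le:
  assumes w: "w \<in> borel_measurable borel" "\<And>x. \<bar>w x\<bar> \<le> C"
  shows "\<bar>remaining w n\<bar> \<le> C * survival n"
proof -
  have C: "0 \<le> C" using abs_ge_zero w(2) order_trans by blast
  have 1: "integrable (hist n) (\<lambda>h. indicator (alive n) h * w (h n))"
    using borel_measurable_stopped[OF w(1)]
    by (intro integrable_stopped[where C=C] abs_stopped_le w(2)) (simp only: measurable_hist)
  have 2: "integrable (hist n) (\<lambda>h. indicator (alive n) h * C)"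
    using borel_measurable_stopped[of "\<lambda>_. C"] C
    by (intro integrable_stopped[where C=C]) (simp_all add: measurable_hist indicator_def)
  have "\<bar>remaining w n\<bar> \<le> (LINT h|hist n. \<bar>indicator (alive n) h * w (h n)\<bar>)"
    unfolding remaining_def by (rule integral_abs_bound)
  also have "\<dots> \<le> (LINT h|hist n. indicator (alive n) h * C)"
    using 1 2 w(2) by (intro integral_mono) (auto simp: indicator_def)
  also have "\<dots> = C * survival n"
    by (simp only: integral_mult_left_zero integral_alive) (rule mult.commute)
  finally show ?thesis .
qed

lemma integral_game_kernel_Suc:
  assumes w[measurable]: "w \<in> borel_measurable borel" and h: "h \<in> space (hist n)"
  shows "(LINT x|game_kernel \<epsilon> x0 Sp Sc (Suc n) h. w x) =
    mean_on surface_measure (Sp (Suc n) h \<inter> Sc (Suc n) h) (\<lambda>v. w (h n + \<epsilon> *\<^sub>R v))"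
proof -
  let ?S = "Sp (Suc n) h \<inter> Sc (Suc n) h"
  have adm: "Sp (Suc n) h \<in> admissible_sets \<epsilon>" "Sc (Suc n) h \<in> admissible_sets \<epsilon>"
    using Sp Sc h by (auto simp: strategies_def space_hist)
  have "(LINT x|game_kernel \<epsilon> x0 Sp Sc (Suc n) h. w x) =
      (LINT v|uniform_measure surface_measure ?S. w (h n + \<epsilon> *\<^sub>R v))"
  proof -
    have "(\<lambda>v. h n + \<epsilon> *\<^sub>R v) \<in> uniform_measure surface_measure ?S \<rightarrow>\<^sub>M borel"
      using measurable_step by (simp add: measurable_cong_sets[OF sets_uniform_measure refl])
    from integral_distr[OF this w] show ?thesis by (simp add: game_kernel_def)
  qed
  also have "\<dots> = mean_on surface_measure ?S (\<lambda>v. w (h n + \<epsilon> *\<^sub>R v))"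
    using adm admissible_Int_pos[OF eps adm]
    by (intro integral_uniform_surface_measure) (auto simp: admissible_sets_borel)
  finally show ?thesis .
qed

text \<open>
  As \<open>w\<close> vanishes outside the domain, the condition that the new position is still inside may be dropped
  before the new position is integrated out.
\<close>

lemma remaining_Suc:
  assumes w: "w \<in> borel_measurable borel" "\<And>x. \<bar>w x\<bar> \<le> C" and w0: "\<And>x. x \<notin> \<Omega> \<Longrightarrow> w x = 0"
  shows "remaining w (Suc n) =
    (LINT h|hist n. indicator (alive n) h *
       mean_on surface_measure (Sp (Suc n) h \<inter> Sc (Suc n) h) (\<lambda>v. w (h n + \<epsilon> *\<^sub>R v)))"
proof -
  have "remaining w (Suc n) = (LINT h|hist n.
      LINT x|game_kernel \<epsilon> x0 Sp Sc (Suc n) h. indicator (alive (Suc n)) (h(Suc n := x)) * w ((h(Suc n := x)) (Suc n)))"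
    unfolding remaining_def hist_def
    by (rule integral_C_Suc[OF borel_measurable_stopped[OF w(1)] abs_stopped_le[of w, OF w(2)]])
  also have "\<dots> = (LINT h|hist n. indicator (alive n) h *
       mean_on surface_measure (Sp (Suc n) h \<inter> Sc (Suc n) h) (\<lambda>v. w (h n + \<epsilon> *\<^sub>R v)))"
  proof (rule Bochner_Integration.integral_cong[OF refl])
    fix h assume h: "h \<in> space (hist n)"
    have stop: "indicator (alive (Suc n)) (h(Suc n := x)) * w ((h(Suc n := x)) (Suc n)) = indicator (alive n) h * w x" for x
      using w0[of x] by (cases "x \<in> \<Omega>") (auto simp: alive_def indicator_def le_Suc_eq)
    show "(LINT x|game_kernel \<epsilon> x0 Sp Sc (Suc n) h. indicator (alive (Suc n)) (h(Suc n := x)) * w ((h(Suc n := x)) (Suc n)))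
       = indicator (alive n) h * mean_on surface_measure (Sp (Suc n) h \<inter> Sc (Suc n) h) (\<lambda>v. w (h n + \<epsilon> *\<^sub>R v))"
      by (simp only: stop integral_mult_right_zero integral_game_kernel_Suc[OF w(1) h])
  qed
  finally show ?thesis .
qed

lemma integrable_next_mean:
  assumes w: "w \<in> borel_measurable borel" "\<And>x. \<bar>w x\<bar> \<le> C"
  shows "integrable (hist n) (\<lambda>h. indicator (alive n) h *
       mean_on surface_measure (Sp (Suc n) h \<inter> Sc (Suc n) h) (\<lambda>v. w (h n + \<epsilon> *\<^sub>R v)))"
proof -
  let ?m = "\<lambda>h. mean_on surface_measure (Sp (Suc n) h \<inter> Sc (Suc n) h) (\<lambda>v. w (h n + \<epsilon> *\<^sub>R v))"
  have C: "0 \<le> C" using abs_ge_zero w(2) order_trans by blast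
  have "(\<lambda>h. LINT x|game_kernel \<epsilon> x0 Sp Sc (Suc n) h. w x) \<in> borel_measurable (hist n)"
    unfolding measurable_hist using IT.P[of "Suc n"] integral_measurable_subprob_algebra[OF w(1)]
    by (rule measurable_compose)
  then have m: "?m \<in> borel_measurable (hist n)"
    by (rule measurable_cong[THEN iffD1, rotated]) (rule integral_game_kernel_Suc[OF w(1)])
  have ind: "(\<lambda>h. indicator (alive n) h :: real) \<in> borel_measurable (hist n)"
    using borel_measurable_stopped[of "\<lambda>_. 1" n] by (simp add: measurable_hist)
  have "(\<lambda>h. indicator (alive n) h * ?m h) \<in> borel_measurable (hist n)"
    using ind m by (rule borel_measurable_times)
  moreover have "\<bar>indicator (alive n) h * ?m h\<bar> \<le> C" if "h \<in> space (hist n)" for h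
  proof -
    have adm: "Sp (Suc n) h \<in> admissible_sets \<epsilon>" "Sc (Suc n) h \<in> admissible_sets \<epsilon>"
      using Sp Sc that by (auto simp: strategies_def space_hist)
    have "\<bar>?m h\<bar> \<le> C"
      using adm admissible_Int_pos[OF eps adm] w
      by (intro surf.abs_mean_on_le) (auto simp: admissible_sets_borel intro!: measurable_compose[OF measurable_step])
    then show ?thesis using C by (simp add: indicator_def)
  qed
  ultimately show ?thesis
    by (intro finite_measure.integrable_const_bound[OF prob_space.finite_measure[OF prob_space_hist], of _ C])
       (auto intro!: AE_I2)
qed

text \<open>
  The supermartingale estimate, with a constant \<open>c\<close> of either sign: for \<open>- w\<close> and \<open>- c\<close> it becomes the
  submartingale estimate needed for the other player.
\<close>

lemma remaining_Suc_le:
  assumes w: "w \<in> borel_measurable borel" "\<And>x. \<bar>w x\<bar> \<le> C" and w0: "\<And>x. x \<notin> \<Omega> \<Longrightarrow> w x = 0"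
    and le: "\<And>h. h \<in> space (hist n) \<Longrightarrow> h n \<in> \<Omega> \<Longrightarrow>
      mean_on surface_measure (Sp (Suc n) h \<inter> Sc (Suc n) h) (\<lambda>v. w (h n + \<epsilon> *\<^sub>R v)) \<le> w (h n) - c"
  shows "remaining w (Suc n) \<le> remaining w n - c * survival n"
proof -
  have int: "integrable (hist n) (\<lambda>h. indicator (alive n) h * w (h n))"
    using borel_measurable_stopped[OF w(1)]
    by (intro integrable_stopped[where C=C] abs_stopped_le w(2)) (simp only: measurable_hist)
  have int1: "integrable (hist n) (\<lambda>h. indicator (alive n) h * c)"
    using borel_measurable_stopped[of "\<lambda>_. c"]
    by (intro integrable_stopped[where C="\<bar>c\<bar>"]) (simp_all add: measurable_hist indicator_def)
  have "remaining w (Suc n) = (LINT h|hist n. indicator (alive n) h *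
       mean_on surface_measure (Sp (Suc n) h \<inter> Sc (Suc n) h) (\<lambda>v. w (h n + \<epsilon> *\<^sub>R v)))"
    by (rule remaining_Suc[OF w w0])
  also have "\<dots> \<le> (LINT h|hist n. indicator (alive n) h * w (h n) - indicator (alive n) h * c)"
    by (intro integral_mono integrable_next_mean[OF w] Bochner_Integration.integrable_diff int int1)
       (use le in \<open>auto simp: indicator_def alive_def\<close>)
  also have "\<dots> = remaining w n - (LINT h|hist n. indicator (alive n) h * c)"
    unfolding remaining_def by (rule Bochner_Integration.integral_diff[OF int int1])
  also have "\<dots> = remaining w n - c * survival n"
    by (simp only: integral_mult_left_zero integral_alive mult.commute[of c])
  finally show ?thesis .
qed

lemma remaining_uminus: "remaining (\<lambda>x. - w x) n = - remaining w n"
  by (simp add: remaining_def)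

text \<open>
  Against saddle sets for \<open>w\<close>, whatever the opponent does, one round brings the mean of \<open>w\<close> down
  to at most \<open>w - \<epsilon>\<^sup>2 * K\<close>. So the expected remaining value loses at least the payment of that round.
\<close>

lemma expected_payoff_le:
  assumes sol: "dpp_solution \<Omega> K \<epsilon> w"
    and saddle: "\<And>n h. saddle_sets \<epsilon> (\<lambda>v. w (h n + \<epsilon> *\<^sub>R v)) (A (h n)) (Sc (Suc n) h)"
  shows "0 \<le> w x0" "expected_payoff \<Omega> K \<epsilon> x0 Sp Sc \<le> ennreal (w x0)"
proof -
  obtain C where wC: "\<And>x. \<bar>w x\<bar> \<le> C"
    using sol by (auto simp: dpp_solution_iff bounded_iff)
  have w: "w \<in> borel_measurable borel" "\<And>x. x \<notin> \<Omega> \<Longrightarrow> w x = 0"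
    and dpp: "\<And>x. x \<in> \<Omega> \<Longrightarrow> w x = round_value \<epsilon> (\<lambda>v. w (x + \<epsilon> *\<^sub>R v)) + \<epsilon>\<^sup>2 * K"
    using sol by (auto simp: dpp_solution_iff)
  have step: "remaining w (Suc n) \<le> remaining w n - \<epsilon>\<^sup>2 * K * survival n" for n
  proof (rule remaining_Suc_le[OF w(1) wC w(2)])
    fix h assume h: "h \<in> space (hist n)" "h n \<in> \<Omega>"
    let ?f = "\<lambda>v. w (h n + \<epsilon> *\<^sub>R v)"
    have f: "?f \<in> borel_measurable borel" by (rule measurable_compose[OF measurable_step w(1)])
    have "Sp (Suc n) h \<in> admissible_sets \<epsilon>" using Sp h by (auto simp: strategies_def space_hist)
    then have "mean_on surface_measure (Sp (Suc n) h \<inter> Sc (Suc n) h) ?f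
        \<le> mean_on surface_measure (A (h n) \<inter> Sc (Suc n) h) ?f"
      by (rule saddle_sets_best_reply_max[OF eps f wC saddle[of h n]])
    also have "\<dots> = w (h n) - \<epsilon>\<^sup>2 * K"
      using dpp[OF h(2)] round_value_eq_saddle[OF eps f wC saddle[of h n]] by simp
    finally show "mean_on surface_measure (Sp (Suc n) h \<inter> Sc (Suc n) h) ?f \<le> w (h n) - \<epsilon>\<^sup>2 * K" .
  qed
  have start: "remaining w 0 = w x0" by (rule remaining_0[OF w(1) wC w(2)])
  have c: "0 < \<epsilon>\<^sup>2 * K" using K eps by simp
  note * = suminf_le_of_decrease[of survival "remaining w" C, OF survival_bounds abs_remaining_le[OF w(1) wC] c step]
  show "0 \<le> w x0" "expected_payoff \<Omega> K \<epsilon> x0 Sp Sc \<le> ennreal (w x0)"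
    using * by (simp_all only: expected_payoff_eq_suminf start)
qed

lemma expected_payoff_ge:
  assumes sol: "dpp_solution \<Omega> K \<epsilon> w"
    and saddle: "\<And>n h. saddle_sets \<epsilon> (\<lambda>v. w (h n + \<epsilon> *\<^sub>R v)) (Sp (Suc n) h) (B (h n))"
  shows "ennreal (w x0) \<le> expected_payoff \<Omega> K \<epsilon> x0 Sp Sc"
proof -
  obtain C where wC: "\<And>x. \<bar>w x\<bar> \<le> C"
    using sol by (auto simp: dpp_solution_iff bounded_iff)
  have w: "w \<in> borel_measurable borel" "\<And>x. x \<notin> \<Omega> \<Longrightarrow> w x = 0"
    and dpp: "\<And>x. x \<in> \<Omega> \<Longrightarrow> w x = round_value \<epsilon> (\<lambda>v. w (x + \<epsilon> *\<^sub>R v)) + \<epsilon>\<^sup>2 * K"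
    using sol by (auto simp: dpp_solution_iff)
  have "remaining (\<lambda>x. - w x) (Suc n) \<le> remaining (\<lambda>x. - w x) n - (- (\<epsilon>\<^sup>2 * K)) * survival n" for n
  proof (rule remaining_Suc_le[where C=C])
    fix h assume h: "h \<in> space (hist n)" "h n \<in> \<Omega>"
    let ?f = "\<lambda>v. w (h n + \<epsilon> *\<^sub>R v)"
    have f: "?f \<in> borel_measurable borel" by (rule measurable_compose[OF measurable_step w(1)])
    have adm: "Sc (Suc n) h \<in> admissible_sets \<epsilon>" using Sc h by (auto simp: strategies_def space_hist)
    have "w (h n) - \<epsilon>\<^sup>2 * K = mean_on surface_measure (Sp (Suc n) h \<inter> B (h n)) ?f"
      using dpp[OF h(2)] round_value_eq_saddle[OF eps f wC saddle[of h n]] by simp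
    also have "\<dots> \<le> mean_on surface_measure (Sp (Suc n) h \<inter> Sc (Suc n) h) ?f"
      by (rule saddle_sets_best_reply_min[OF eps f wC saddle[of h n] adm])
    finally show "mean_on surface_measure (Sp (Suc n) h \<inter> Sc (Suc n) h) (\<lambda>v. - w (h n + \<epsilon> *\<^sub>R v))
        \<le> - w (h n) - - (\<epsilon>\<^sup>2 * K)"
      by (simp add: surf.mean_on_uminus)
  qed (use w wC in auto)
  then have step: "remaining w n - \<epsilon>\<^sup>2 * K * survival n \<le> remaining w (Suc n)" for n
    by (simp only: remaining_uminus) (simp add: algebra_simps)
  have start: "remaining w 0 = w x0" by (rule remaining_0[OF w(1) wC w(2)])
  have c: "0 < \<epsilon>\<^sup>2 * K" using K eps by simp
  show ?thesis
    using suminf_ge_of_slow_decrease[of survival "remaining w" C, OF survival_bounds(1) abs_remaining_le[OF w(1) wC] c step]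
    by (simp only: expected_payoff_eq_suminf start)
qed

end

section \<open>The value of the game\<close>

lemma Markov_strategy:
  fixes A :: "'a::euclidean_space \<Rightarrow> 'a set"
  assumes A: "Sigma UNIV A \<in> sets (borel \<Otimes>\<^sub>M borel)" and adm: "\<And>x. A x \<in> admissible_sets \<epsilon>"
  shows "(\<lambda>i h. A (h (i - 1))) \<in> strategies \<epsilon>"
  unfolding strategies_def
proof (intro CollectI allI impI conjI ballI adm)
  fix i :: nat assume i: "1 \<le> i"
  let ?H = "PiM {0..<i} (\<lambda>_. borel :: 'a measure)"
  have [measurable]: "(\<lambda>h. h (i - 1)) \<in> ?H \<rightarrow>\<^sub>M borel"
    using i by (intro measurable_component_singleton) auto
  note [measurable] = A
  have "Sigma (space ?H) (\<lambda>h. A (h (i - 1))) =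
      {p \<in> space (?H \<Otimes>\<^sub>M borel). (fst p (i - 1), snd p) \<in> Sigma UNIV A}"
    by (auto simp: space_pair_measure)
  also have "\<dots> \<in> sets (?H \<Otimes>\<^sub>M borel)" by measurable
  finally show "Sigma (space ?H) (\<lambda>h. A (h (i - 1))) \<in> sets (?H \<Otimes>\<^sub>M borel)" .
qed

text \<open>
  Every bounded solution of the equation, and not only the one found by iteration, yields optimal
  strategies for both players and is therefore the value of the game. This is also what proves uniqueness.
\<close>

lemma (in random_direction_game) value_eq_dpp_solution:
  assumes sol: "dpp_solution \<Omega> K \<epsilon> w"
  shows "paul_value \<Omega> K \<epsilon> x = ennreal (w x)" "carol_value \<Omega> K \<epsilon> x = ennreal (w x)" "0 \<le> w x"
proof -
  have w: "w \<in> borel_measurable borel" using sol by (simp add: dpp_solution_iff)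
  obtain A B where AB: "Sigma UNIV A \<in> sets (borel \<Otimes>\<^sub>M borel)" "Sigma UNIV B \<in> sets (borel \<Otimes>\<^sub>M borel)"
    and saddle: "\<And>x. saddle_sets \<epsilon> (\<lambda>v. w (x + \<epsilon> *\<^sub>R v)) (A x) (B x)"
    using exists_saddle_selection[OF w] by blast
  define SP :: "nat \<Rightarrow> (nat \<Rightarrow> 'a) \<Rightarrow> 'a set" where "SP = (\<lambda>i h. A (h (i - 1)))"
  define SC :: "nat \<Rightarrow> (nat \<Rightarrow> 'a) \<Rightarrow> 'a set" where "SC = (\<lambda>i h. B (h (i - 1)))"
  have SP: "SP \<in> strategies \<epsilon>" and SC: "SC \<in> strategies \<epsilon>"
    unfolding SP_def SC_def using saddle
    by (intro Markov_strategy AB; simp add: saddle_sets_def)+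
  have play: "random_direction_play \<Omega> K \<epsilon> Sp Sc" if "Sp \<in> strategies \<epsilon>" "Sc \<in> strategies \<epsilon>" for Sp Sc
    using that by unfold_locales
  have up: "expected_payoff \<Omega> K \<epsilon> x Sp SC \<le> ennreal (w x)" and nonneg: "0 \<le> w x" if "Sp \<in> strategies \<epsilon>" for Sp
    using random_direction_play.expected_payoff_le[OF play[OF that SC] sol, of A x] saddle
    by (simp_all add: SC_def)
  have lo: "ennreal (w x) \<le> expected_payoff \<Omega> K \<epsilon> x SP Sc" if "Sc \<in> strategies \<epsilon>" for Sc
    using random_direction_play.expected_payoff_ge[OF play[OF SP that] sol, of B x] saddle
    by (simp add: SP_def)
  show "0 \<le> w x" using nonneg SP .
  have "paul_value \<Omega> K \<epsilon> x \<le> ennreal (w x)"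
    unfolding paul_value_def using SC up by (intro INF_lower2[of SC] SUP_least)
  moreover have "carol_value \<Omega> K \<epsilon> x \<le> paul_value \<Omega> K \<epsilon> x"
    unfolding paul_value_def carol_value_def
    by (intro SUP_least INF_greatest) (meson INF_lower2 SUP_upper order_refl order_trans)
  moreover have "ennreal (w x) \<le> carol_value \<Omega> K \<epsilon> x"
    unfolding carol_value_def using SP lo by (intro SUP_upper2[of SP] INF_greatest)
  ultimately show "paul_value \<Omega> K \<epsilon> x = ennreal (w x)" "carol_value \<Omega> K \<epsilon> x = ennreal (w x)"
    by auto
qed

theorem theorem1p2:
  fixes \<Omega> :: "'a::euclidean_space set" and K \<epsilon> :: real
  assumes "DIM('a) \<ge> 2"
    and "open \<Omega>" and "connected \<Omega>" and "\<Omega> \<noteq> {}" and "bounded \<Omega>" and "strictly_convex \<Omega>"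
    and "K > 0" and "\<epsilon> > 0"
    and "(admissible_sets \<epsilon> :: 'a set set) \<noteq> {}"
  shows "\<exists>u. (\<forall>x. paul_value \<Omega> K \<epsilon> x = ennreal (u x) \<and> carol_value \<Omega> K \<epsilon> x = ennreal (u x) \<and> 0 \<le> u x)
           \<and> dpp_solution \<Omega> K \<epsilon> u \<and> (\<forall>w. dpp_solution \<Omega> K \<epsilon> w \<longrightarrow> w = u)"
proof -
  interpret random_direction_game \<Omega> K \<epsilon>
    using assms by unfold_locales
  obtain u where u: "dpp_solution \<Omega> K \<epsilon> u" using exists_dpp_solution by blast
  have "w = u" if w: "dpp_solution \<Omega> K \<epsilon> w" for w
  proof
    fix x
    have "ennreal (w x) = ennreal (u x)"
      using value_eq_dpp_solution(1)[OF w, of x] value_eq_dpp_solution(1)[OF u, of x] by simp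
    then show "w x = u x"
      using value_eq_dpp_solution(3)[OF w] value_eq_dpp_solution(3)[OF u] by simp
  qed
  with u value_eq_dpp_solution[OF u] show ?thesis by blast
qed

end
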